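(* Let $(X,\mu)$ be a computable probability space, $n\ge 1$, and $A\subseteq\mathbb N$. If $x\in X$ is both Schnorr $n$-random relative to $A$ and quasi-$\Pi^0_n$-generic relative to $A$, then for any $\Pi^0_n(A)$ set $P\ni x$ with $\mu(P)>0$ and any computable measure-preserving transformation $T:\subseteq X\to X$ with $x\in\operatorname{dom}T$, we have $T^k(x)\in P$ for some $k>0$.
   Context: Uniformity: a sequence of objects has a property (whose definition involves an index in $\mathbb N$) uniformly if a computable function produces suitable indices. $A^{(m)}$ denotes the $m$-th Turing jump of $A$. A computable metric space is a triple $(X,d,S)$ where $(X,d)$ is a complete separable metric space, $S=(s_i)_i$ is a dense sequence in $X$, and $d(s_i,s_j)$ is a computable real number uniformly in $i,j$. With $(q_j)_j$ a fixed enumeration of the positive rationals and $\langle\cdot,\cdot\rangle$ the standard pairing function, the ideal balls are $B_{\langle i,j\rangle}=\{x\in X: d(x,s_i)<q_j\}$. For an oracle $A\subseteq\mathbb N$: a set $U\subseteq X$ is $\Sigma^0_1(A)$ if $U=\bigcup_{i\in W}B_i$ for some $A$-c.e. $W\subseteq\mathbb N$ (its index is an index of $W$). A set is $\Pi^0_n(A)$ if its complement is $\Sigma^0_n(A)$. A set is $\Sigma^0_{n+1}(A)$ if it equals $\bigcup_{i\in W}(X\setminus U^n_i)$ for some $A$-c.e. $W\subseteq\mathbb N$, where $U^n_i$ is the $i$-th $\Sigma^0_n(A)$ set. Omit $(A)$ when $A=\emptyset$. For $D\subseteq X$, a subset of $D$ is $\Sigma^0_1$ in $D$ if it is the intersection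 of $D$ with a $\Sigma^0_1$ subset of $X$. A computable probability space $(X,\mu)$ is a computable metric space with a Borel probability measure $\mu$ such that $\mu(\bigcup_{i\in F}B_i)$ is lower-semicomputable uniformly in finite $F\subseteq\mathbb N$. A Schnorr $n$-test relative to $A$ is a sequence $(U_k)_k$ of uniformly $\Sigma^0_n(A)$ sets with $\mu(U_k)\le 2^{-k}$ for all $k$ and $\mu(U_k)$ uniformly $A^{(n-1)}$-computable in $k$. A point $x$ is Schnorr $n$-random relative to $A$ if $x\notin\bigcap_kU_k$ for every such test. A point $x\in X$ is quasi-$\Pi^0_n$-generic relative to $A$ if for any $\Pi^0_n(A)$ set $P\ni x$ there is a $\Pi^0_1(A^{(n-1)})$ set $Q\subseteq P$ such that $\mu(Q)>0$, $\mu(Q)$ is $A^{(n-1)}$-computable, and $x\in Q$. A measure-preserving transformation is a partial Borel measurable map $T:\subseteq X\to X$ such that $\mu(T^{-1}(B))=\mu(B)$ for every Borel $B$ (so $\operatorname{dom}T$ has full measure) and $x\in\operatorname{dom}T$ implies $T(x)\in\operatorname{dom}T$. It is computable if the sets $T^{-1}(B_i)$ are uniformly $\Sigma^0_1$ in $\operatorname{dom}T$. *)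

theory Defs
  imports
    "HOL-Probability.Probability_Measure"
    "HOL-Library.Nat_Bijection"
    "HOL-Library.Countable"
begin

section \<open>Relative computability on the natural numbers\<close>

text \<open>
  Programs for the unary partial recursive functions relative to a set of natural numbers.
  Functions of several arguments are handled through the Cantor pairing function
  \<^const>\<open>prod_encode\<close>.
\<close>

datatype prog =
    Zero
  | Succ
  | First
  | Second
  | Query
  | Pair prog prog
  | Comp prog prog
  | Rec prog prog
  | Mu prog

text \<open>
  \<open>run A c x\<close> is the result of program \<open>c\<close> on input \<open>x\<close>, where \<open>Query\<close> evaluates the
  characteristic function of \<open>A\<close>; \<^const>\<open>None\<close> means divergence.
\<close>

primrec run :: "nat set \<Rightarrow> prog \<Rightarrow> nat \<rightharpoonup> nat" where
  "run A Zero = (\<lambda>x. Some 0)"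
| "run A Succ = (\<lambda>x. Some (Suc x))"
| "run A First = (\<lambda>x. Some (fst (prod_decode x)))"
| "run A Second = (\<lambda>x. Some (snd (prod_decode x)))"
| "run A Query = (\<lambda>x. Some (if x \<in> A then 1 else 0))"
| "run A (Pair c d) = (\<lambda>x. Option.bind (run A c x) (\<lambda>y.
     Option.bind (run A d x) (\<lambda>z. Some (prod_encode (y, z)))))"
| "run A (Comp c d) = (\<lambda>x. Option.bind (run A d x) (run A c))"
| "run A (Rec c d) = (\<lambda>x. case prod_decode x of (a, n) \<Rightarrow>
     rec_nat (run A c a)
       (\<lambda>m r. Option.bind r (\<lambda>y. run A d (prod_encode (a, prod_encode (m, y))))) n)"
| "run A (Mu c) = (\<lambda>x.
     let is_result = (\<lambda>m. run A c (prod_encode (x, m)) = Some 0 \<and>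
           (\<forall>k<m. \<exists>v. run A c (prod_encode (x, k)) = Some (Suc v)))
     in if \<exists>m. is_result m then Some (LEAST m. is_result m) else None)"

primrec prog_encode :: "prog \<Rightarrow> nat" where
  "prog_encode Zero = prod_encode (0, 0)"
| "prog_encode Succ = prod_encode (1, 0)"
| "prog_encode First = prod_encode (2, 0)"
| "prog_encode Second = prod_encode (3, 0)"
| "prog_encode Query = prod_encode (4, 0)"
| "prog_encode (Pair c d) = prod_encode (5, prod_encode (prog_encode c, prog_encode d))"
| "prog_encode (Comp c d) = prod_encode (6, prod_encode (prog_encode c, prog_encode d))"
| "prog_encode (Rec c d) = prod_encode (7, prod_encode (prog_encode c, prog_encode d))"
| "prog_encode (Mu c) = prod_encode (8, prog_encode c)"

lemma prog_encode_eq_iff [simp]: "prog_encode c = prog_encode d \<longleftrightarrow> c = d"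
proof (induction c arbitrary: d)
  case Zero show ?case by (cases d) auto
next
  case Succ show ?case by (cases d) auto
next
  case First show ?case by (cases d) auto
next
  case Second show ?case by (cases d) auto
next
  case Query show ?case by (cases d) auto
next
  case Pair then show ?case by (cases d) auto
next
  case Comp then show ?case by (cases d) auto
next
  case Rec then show ?case by (cases d) auto
next
  case Mu then show ?case by (cases d) auto
qed

text \<open>
  The \<open>e\<close>-th partial \<open>A\<close>-computable function; the empty function if \<open>e\<close> is not the code of
  a program.
\<close>

definition part_fun :: "nat set \<Rightarrow> nat \<Rightarrow> nat \<rightharpoonup> nat" where
  "part_fun A e = (if e \<in> range prog_encode then run A (inv prog_encode e) else Map.empty)"

definition ce_set :: "nat set \<Rightarrow> nat \<Rightarrow> nat set" where
  "ce_set A e = dom (part_fun A e)"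

definition jump :: "nat set \<Rightarrow> nat set" where
  "jump A = {e. e \<in> ce_set A e}"

definition iter_jump :: "nat \<Rightarrow> nat set \<Rightarrow> nat set" where
  "iter_jump m = jump ^^ m"

definition computable_fun :: "(nat \<Rightarrow> nat) \<Rightarrow> bool" where
  "computable_fun f \<longleftrightarrow> (\<exists>e. \<forall>x. part_fun {} e x = Some (f x))"

text \<open>
  For a relation \<open>R e y\<close> saying that \<open>e\<close> is an index of \<open>y\<close>: the objects \<open>y k\<close> have indices
  produced by a computable function.
\<close>

definition uniformly :: "(nat \<Rightarrow> 'b \<Rightarrow> bool) \<Rightarrow> (nat \<Rightarrow> 'b) \<Rightarrow> bool" where
  "uniformly R y \<longleftrightarrow> (\<exists>f. computable_fun f \<and> (\<forall>k. R (f k) (y k)))"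

text \<open>
  Rationals are named by \<^const>\<open>nat_to_rat_surj\<close>. An index of an \<open>A\<close>-computable real computes
  from \<open>m\<close> (with queries to \<open>A\<close>) a name of a rational at distance at most \<open>2^-m\<close>; an index of
  a lower-semicomputable real enumerates its left cut.
\<close>

definition computes_real :: "nat set \<Rightarrow> nat \<Rightarrow> real \<Rightarrow> bool" where
  "computes_real A e r \<longleftrightarrow>
     (\<forall>m. \<exists>j. part_fun A e m = Some j \<and> \<bar>of_rat (nat_to_rat_surj j) - r\<bar> \<le> (1/2) ^ m)"

definition lower_semicomputes_real :: "nat \<Rightarrow> real \<Rightarrow> bool" where
  "lower_semicomputes_real e r \<longleftrightarrow> ce_set {} e = {j. of_rat (nat_to_rat_surj j) < r}"


section \<open>Computable metric spaces and probability spaces\<close>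

definition computable_metric_space :: "(nat \<Rightarrow> 'a::polish_space) \<Rightarrow> bool" where
  "computable_metric_space s \<longleftrightarrow>
     closure (range s) = UNIV \<and>
     uniformly (computes_real {}) (\<lambda>k. case prod_decode k of (i, j) \<Rightarrow> dist (s i) (s j))"

definition pos_rat :: "nat \<Rightarrow> rat" where
  "pos_rat k = (case prod_decode k of (a, b) \<Rightarrow> of_nat (Suc a) / of_nat (Suc b))"

definition ideal_ball :: "(nat \<Rightarrow> 'a::polish_space) \<Rightarrow> nat \<Rightarrow> 'a set" where
  "ideal_ball s k = (case prod_decode k of (i, j) \<Rightarrow> {x. dist x (s i) < of_rat (pos_rat j)})"

text \<open>Finite sets of natural numbers are given by their canonical index under \<^const>\<open>set_decode\<close>.\<close>

definition computable_prob_space :: "(nat \<Rightarrow> 'a::polish_space) \<Rightarrow> 'a measure \<Rightarrow> bool" where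
  "computable_prob_space s \<mu> \<longleftrightarrow>
     computable_metric_space s \<and> prob_space \<mu> \<and> sets \<mu> = sets borel \<and>
     uniformly lower_semicomputes_real (\<lambda>u. measure \<mu> (\<Union>i\<in>set_decode u. ideal_ball s i))"

text \<open>
  \<open>Sigma_set s A n e\<close> is the \<open>e\<close>-th \<open>\<Sigma>\<^sup>0\<^sub>n(A)\<close> set, for \<open>n \<ge> 1\<close>; the value at level \<open>0\<close> is
  a dummy.
\<close>

fun Sigma_set :: "(nat \<Rightarrow> 'a::polish_space) \<Rightarrow> nat set \<Rightarrow> nat \<Rightarrow> nat \<Rightarrow> 'a set" where
  "Sigma_set s A 0 e = {}"
| "Sigma_set s A (Suc 0) e = (\<Union>i\<in>ce_set A e. ideal_ball s i)"
| "Sigma_set s A (Suc (Suc n)) e = (\<Union>i\<in>ce_set A e. - Sigma_set s A (Suc n) i)"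

definition is_Sigma :: "(nat \<Rightarrow> 'a::polish_space) \<Rightarrow> nat set \<Rightarrow> nat \<Rightarrow> 'a set \<Rightarrow> bool" where
  "is_Sigma s A n U \<longleftrightarrow> (\<exists>e. U = Sigma_set s A n e)"

definition is_Pi :: "(nat \<Rightarrow> 'a::polish_space) \<Rightarrow> nat set \<Rightarrow> nat \<Rightarrow> 'a set \<Rightarrow> bool" where
  "is_Pi s A n P \<longleftrightarrow> is_Sigma s A n (- P)"


section \<open>Randomness and genericity\<close>

definition schnorr_test ::
  "(nat \<Rightarrow> 'a::polish_space) \<Rightarrow> 'a measure \<Rightarrow> nat set \<Rightarrow> nat \<Rightarrow> (nat \<Rightarrow> 'a set) \<Rightarrow> bool" where
  "schnorr_test s \<mu> A n U \<longleftrightarrow>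
     uniformly (\<lambda>e V. V = Sigma_set s A n e) U \<and>
     (\<forall>k. measure \<mu> (U k) \<le> (1/2) ^ k) \<and>
     uniformly (computes_real (iter_jump (n - 1) A)) (\<lambda>k. measure \<mu> (U k))"

definition schnorr_random ::
  "(nat \<Rightarrow> 'a::polish_space) \<Rightarrow> 'a measure \<Rightarrow> nat set \<Rightarrow> nat \<Rightarrow> 'a \<Rightarrow> bool" where
  "schnorr_random s \<mu> A n x \<longleftrightarrow> (\<forall>U. schnorr_test s \<mu> A n U \<longrightarrow> x \<notin> (\<Inter>k. U k))"

definition quasi_Pi_generic ::
  "(nat \<Rightarrow> 'a::polish_space) \<Rightarrow> 'a measure \<Rightarrow> nat set \<Rightarrow> nat \<Rightarrow> 'a \<Rightarrow> bool" where
  "quasi_Pi_generic s \<mu> A n x \<longleftrightarrow>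
     (\<forall>P. is_Pi s A n P \<and> x \<in> P \<longrightarrow>
       (\<exists>Q. is_Pi s (iter_jump (n - 1) A) 1 Q \<and> Q \<subseteq> P \<and> measure \<mu> Q > 0 \<and>
         (\<exists>e. computes_real (iter_jump (n - 1) A) e (measure \<mu> Q)) \<and> x \<in> Q))"


section \<open>Partial measure-preserving transformations\<close>

definition partial_preimage :: "('a \<rightharpoonup> 'a) \<Rightarrow> 'a set \<Rightarrow> 'a set" where
  "partial_preimage T B = {x. \<exists>y\<in>B. T x = Some y}"

definition measure_preserving_map :: "'a::polish_space measure \<Rightarrow> ('a \<rightharpoonup> 'a) \<Rightarrow> bool" where
  "measure_preserving_map \<mu> T \<longleftrightarrow>
     (\<forall>B\<in>sets borel. partial_preimage T B \<in> sets borel \<and>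
        measure \<mu> (partial_preimage T B) = measure \<mu> B) \<and>
     ran T \<subseteq> dom T"

definition computable_map :: "(nat \<Rightarrow> 'a::polish_space) \<Rightarrow> ('a \<rightharpoonup> 'a) \<Rightarrow> bool" where
  "computable_map s T \<longleftrightarrow>
     uniformly (\<lambda>e V. V = dom T \<inter> Sigma_set s {} 1 e) (\<lambda>i. partial_preimage T (ideal_ball s i))"

definition partial_iterate :: "('a \<rightharpoonup> 'a) \<Rightarrow> nat \<Rightarrow> ('a \<rightharpoonup> 'a)" where
  "partial_iterate T k = ((\<lambda>F. T \<circ>\<^sub>m F) ^^ k) Some"

end

theory Submission
  imports Defs
begin

text \<open>
  Let \<open>B\<close> be the \<open>(n - 1)\<close>-st jump of \<open>A\<close> and \<open>Q \<subseteq> P\<close> be the \<open>\<Pi>\<^sub>1(B)\<close> set of \<open>B\<close>-computable measure given by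
  genericity, \<open>U = - Q\<close>. If \<open>x\<close> never returns to \<open>P\<close>, it lies in \<open>Q \<inter> V\<^sub>j\<close> for all \<open>j\<close>, where \<open>V\<^sub>j\<close> is
  the set of points whose iterates \<open>1, \<dots>, j\<close> are in \<open>U\<close>. The preimages of \<open>Q \<inter> V\<^sub>j\<close> under the
  iterates \<open>0, \<dots>, j\<close> are disjoint, so its measure is at most \<open>1 / (j + 1)\<close>. Writing \<open>Q\<close> as
  \<open>{f \<le> 0}\<close> for a computable function \<open>f\<close>, the set \<open>V\<^sub>j \<inter> {f < c}\<close> is \<open>\<Sigma>\<^sub>1(B)\<close>, and it has computable
  measure if \<open>{f = c}\<close> is null; such a small \<open>c > 0\<close> is found by nested intervals. These sets form a
  Schnorr test containing \<open>x\<close>, because \<open>\<Sigma>\<^sub>1(B)\<close> sets are uniformly \<open>\<Sigma>\<^sub>n(A)\<close>.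
\<close>

section \<open>Computable functions\<close>

text \<open>The obstacle is the upper bound on the measure of the test sets. Effectively open sets
  have only lower semicomputable measure, so the complement of a test set W must be exhausted, up to
  small measure, by effectively open sets. Up to a null set, this complement consists of the points
  with f >= c and of the points one of whose next j iterates lies in Q. The first set is
  approximated by {f > b}, where {c <= f <= b} has small measure. The second is enlarged to the
  points one of whose iterates lies in {f < t}; since T preserves the measure, the excess inside W
  is at most j times the measure of {0 < f < t}, which tends to 0 with t. It is controlled
  effectively because the measure of Q is computable. The bound 2^-k on W is split in two halves: j
  = 2^(k+1) iterates make the part inside Q small, and c is chosen so that {0 < f < c} has measure
  below 2^-(k+1). As T is continuous only on its domain, preimages are replaced by open sets with
  the same trace on \<open>dom T\<close>, which is invariant and of full measure.\<close>

definition pfst :: "nat \<Rightarrow> nat" where "pfst z = fst (prod_decode z)"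
definition psnd :: "nat \<Rightarrow> nat" where "psnd z = snd (prod_decode z)"

lemma pfst_prod_encode [simp]: "pfst (prod_encode (a, b)) = a"
  and psnd_prod_encode [simp]: "psnd (prod_encode (a, b)) = b"
  and prod_encode_pfst_psnd [simp]: "prod_encode (pfst z, psnd z) = z"
  by (simp_all add: pfst_def psnd_def)

lemma prod_decode_eq_pair: "prod_decode z = (pfst z, psnd z)"
  by (simp add: pfst_def psnd_def)

lemma psnd_le: "psnd z \<le> z"
  by (metis le_prod_encode_2 prod_encode_pfst_psnd)

lemma pfst_le: "pfst z \<le> z"
  by (metis le_prod_encode_1 prod_encode_pfst_psnd)

text \<open>\<open>prod_encode (a, b)\<close> is the triangular number of a + b, plus a; so z
  exceeds its second component as soon as the first one is positive. Codes with constructor tags 5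
  to 8 can thus be decoded by well-founded induction.\<close>

lemma psnd_less: "0 < pfst z \<Longrightarrow> psnd z < z"
proof -
  assume a: "0 < pfst z"
  have le: "k \<le> triangle k" for k by (induction k) auto
  have "prod_encode (pfst z, psnd z) = triangle (pfst z + psnd z) + pfst z"
    by (simp only: prod_encode_def split_conv)
  then have "z = triangle (pfst z + psnd z) + pfst z" by simp
  with le[of "pfst z + psnd z"] a show ?thesis by linarith
qed

text \<open>Several arguments are packed into one and taken apart with \<open>pfst\<close> and
  \<open>psnd\<close>. Asking for the existence of a program, without naming an index, turns
  computability into syntax-directed introduction rules (\<open>comp_intros\<close>); indices return
  with the s-m-n lemmas.\<close>

definition cfun :: "nat set \<Rightarrow> (nat \<Rightarrow> nat) \<Rightarrow> bool" where
  "cfun A f \<longleftrightarrow> (\<exists>c. \<forall>x. run A c x = Some (f x))"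

definition cpred :: "nat set \<Rightarrow> (nat \<Rightarrow> bool) \<Rightarrow> bool" where
  "cpred A R \<longleftrightarrow> cfun A (\<lambda>x. of_bool (R x))"

named_theorems comp_intros

lemma cfun_const [comp_intros]: "cfun A (\<lambda>x. k)"
proof (induction k)
  case 0 show ?case unfolding cfun_def by (intro exI[of _ Zero]) simp
next
  case (Suc k)
  then obtain c where "\<forall>x. run A c x = Some k" by (auto simp: cfun_def)
  then show ?case unfolding cfun_def by (intro exI[of _ "Comp Succ c"]) simp
qed

lemma cfun_id [comp_intros]: "cfun A (\<lambda>x. x)"
  unfolding cfun_def by (intro exI[of _ "Pair First Second"]) simp

lemma cfun_comp: "cfun A g \<Longrightarrow> cfun A f \<Longrightarrow> cfun A (\<lambda>x. g (f x))"
proof -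
  assume "cfun A g" "cfun A f"
  then obtain c d where "\<forall>x. run A c x = Some (g x)" "\<forall>x. run A d x = Some (f x)"
    by (auto simp: cfun_def)
  then show ?thesis unfolding cfun_def by (intro exI[of _ "Comp c d"]) simp
qed

lemma cfun_pfst [comp_intros]: "cfun A f \<Longrightarrow> cfun A (\<lambda>x. pfst (f x))"
  by (rule cfun_comp[of _ pfst]) (auto simp: cfun_def pfst_def intro: exI[of _ First])

lemma cfun_psnd [comp_intros]: "cfun A f \<Longrightarrow> cfun A (\<lambda>x. psnd (f x))"
  by (rule cfun_comp[of _ psnd]) (auto simp: cfun_def psnd_def intro: exI[of _ Second])

lemma cfun_Suc [comp_intros]: "cfun A f \<Longrightarrow> cfun A (\<lambda>x. Suc (f x))"
  by (rule cfun_comp[of _ Suc]) (auto simp: cfun_def intro: exI[of _ Succ])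

lemma cfun_prod_encode [comp_intros]:
  "cfun A f \<Longrightarrow> cfun A g \<Longrightarrow> cfun A (\<lambda>x. prod_encode (f x, g x))"
proof -
  assume "cfun A f" "cfun A g"
  then obtain c d where "\<forall>x. run A c x = Some (f x)" "\<forall>x. run A d x = Some (g x)"
    by (auto simp: cfun_def)
  then show ?thesis unfolding cfun_def by (intro exI[of _ "Pair c d"]) simp
qed

lemma cpred_oracle: "cfun A f \<Longrightarrow> cpred A (\<lambda>x. f x \<in> A)"
  unfolding cpred_def
  by (rule cfun_comp[of _ "\<lambda>x. of_bool (x \<in> A)"]) (auto simp: cfun_def intro!: exI[of _ Query])

lemma cfun_rec_nat [comp_intros]:
  assumes "cfun A f" "cfun A (\<lambda>z. h (pfst z) (pfst (psnd z)) (psnd (psnd z)))" "cfun A n"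
  shows "cfun A (\<lambda>x. rec_nat (f x) (h x) (n x))"
proof -
  obtain c d e where c: "\<And>x. run A c x = Some (f x)"
    and d: "\<And>z. run A d z = Some (h (pfst z) (pfst (psnd z)) (psnd (psnd z)))"
    and e: "\<And>x. run A e x = Some (n x)"
    using assms by (auto simp: cfun_def)
  have "run A (Rec c d) (prod_encode (x, k)) = Some (rec_nat (f x) (h x) k)" for x k
    by (induction k) (simp_all add: c d)
  then have "cfun A (\<lambda>z. rec_nat (f (pfst z)) (h (pfst z)) (psnd z))"
    unfolding cfun_def by (metis prod_encode_pfst_psnd)
  from cfun_comp[OF this cfun_prod_encode[OF cfun_id assms(3)]] show ?thesis by simp
qed

lemma cfun_funpow:
  assumes "cfun A h" "cfun A f" "cfun A n"
  shows "cfun A (\<lambda>x. (h ^^ n x) (f x))"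
proof -
  have eq: "(h ^^ k) y = rec_nat y (\<lambda>_. h) k" for k y by (induction k) auto
  show ?thesis unfolding eq by (intro comp_intros cfun_comp[OF assms(1)] assms)
qed

lemma cfun_add [comp_intros]: "cfun A f \<Longrightarrow> cfun A g \<Longrightarrow> cfun A (\<lambda>x. f x + g x)"
proof -
  assume *: "cfun A f" "cfun A g"
  have eq: "a + b = rec_nat a (\<lambda>_. Suc) b" for a b by (induction b) auto
  show ?thesis unfolding eq by (intro comp_intros * *[THEN cfun_comp])
qed

lemma cfun_mult [comp_intros]: "cfun A f \<Longrightarrow> cfun A g \<Longrightarrow> cfun A (\<lambda>x. f x * g x)"
proof -
  assume *: "cfun A f" "cfun A g"
  have eq: "a * b = rec_nat 0 (\<lambda>_ r. r + a) b" for a b :: nat by (induction b) auto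
  show ?thesis unfolding eq by (intro comp_intros * *[THEN cfun_comp])
qed

lemma cfun_power [comp_intros]: "cfun A f \<Longrightarrow> cfun A g \<Longrightarrow> cfun A (\<lambda>x. f x ^ g x)"
proof -
  assume *: "cfun A f" "cfun A g"
  have eq: "a ^ b = rec_nat 1 (\<lambda>_ r. r * a) b" for a b :: nat by (induction b) auto
  show ?thesis unfolding eq by (intro comp_intros * *[THEN cfun_comp])
qed

lemma cfun_diff [comp_intros]: "cfun A f \<Longrightarrow> cfun A g \<Longrightarrow> cfun A (\<lambda>x. f x - g x)"
proof -
  assume *: "cfun A f" "cfun A g"
  have pred: "k - 1 = rec_nat 0 (\<lambda>m _. m) k" for k by (cases k) auto
  have eq: "a - b = rec_nat a (\<lambda>_ r. rec_nat 0 (\<lambda>m _. m) r) b" for a b :: nat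
    by (induction b) (auto simp flip: pred)
  show ?thesis unfolding eq by (intro comp_intros * *[THEN cfun_comp])
qed

lemma cpred_const [comp_intros]: "cpred A (\<lambda>x. b)"
  unfolding cpred_def by (rule cfun_const)

lemma cfun_if [comp_intros]:
  assumes "cpred A R" "cfun A f" "cfun A g"
  shows "cfun A (\<lambda>x. if R x then f x else g x)"
proof -
  have eq: "(if R x then f x else g x) = of_bool (R x) * f x + (1 - of_bool (R x)) * g x" for x
    by simp
  show ?thesis unfolding eq using assms by (intro comp_intros) (simp_all add: cpred_def)
qed

lemma cpred_subst: "cpred A R \<Longrightarrow> cfun A f \<Longrightarrow> cpred A (\<lambda>x. R (f x))"
  unfolding cpred_def by (rule cfun_comp[of A "\<lambda>x. of_bool (R x)"])

lemma cpred_not [comp_intros]: "cpred A R \<Longrightarrow> cpred A (\<lambda>x. \<not> R x)"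
proof -
  assume *: "cpred A R"
  have "cfun A (\<lambda>x. if R x then 0 else 1)" by (intro comp_intros *)
  moreover have "(\<lambda>x. if R x then 0 else 1) = (\<lambda>x. of_bool (\<not> R x) :: nat)" by auto
  ultimately show ?thesis by (simp add: cpred_def)
qed

lemma cpred_and [comp_intros]: "cpred A R \<Longrightarrow> cpred A S \<Longrightarrow> cpred A (\<lambda>x. R x \<and> S x)"
proof -
  assume *: "cpred A R" "cpred A S"
  then show ?thesis using cfun_mult[of A "\<lambda>x. of_bool (R x)" "\<lambda>x. of_bool (S x)"]
    by (simp add: cpred_def of_bool_conj)
qed

lemma cpred_or [comp_intros]: "cpred A R \<Longrightarrow> cpred A S \<Longrightarrow> cpred A (\<lambda>x. R x \<or> S x)"
  using cpred_not[of A "\<lambda>x. \<not> R x \<and> \<not> S x"] by (simp add: cpred_and cpred_not)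

lemma cpred_imp [comp_intros]: "cpred A R \<Longrightarrow> cpred A S \<Longrightarrow> cpred A (\<lambda>x. R x \<longrightarrow> S x)"
  unfolding imp_conv_disj by (intro comp_intros)

lemma cpred_less [comp_intros]: "cfun A f \<Longrightarrow> cfun A g \<Longrightarrow> cpred A (\<lambda>x. f x < g x)"
proof -
  assume *: "cfun A f" "cfun A g"
  have eq: "of_bool (a < b) = rec_nat 0 (\<lambda>_ _. 1::nat) (b - a)" for a b :: nat
    by (cases "b - a") auto
  show ?thesis unfolding cpred_def eq by (intro comp_intros * *[THEN cfun_comp])
qed

lemma cpred_le [comp_intros]: "cfun A f \<Longrightarrow> cfun A g \<Longrightarrow> cpred A (\<lambda>x. f x \<le> g x)"
  unfolding not_less[symmetric] by (intro comp_intros)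

lemma cpred_eq [comp_intros]: "cfun A f \<Longrightarrow> cfun A g \<Longrightarrow> cpred A (\<lambda>x. f x = g x)"
  unfolding order_eq_iff by (intro comp_intros)

section \<open>Bounded quantifiers, unbounded search, coded finite sets\<close>

lemma cpred_bex [comp_intros]:
  assumes "cpred A (\<lambda>z. R (pfst z) (psnd z))" "cfun A n"
  shows "cpred A (\<lambda>x. \<exists>k<n x. R x k)"
proof -
  have eq: "of_bool (\<exists>k<m. R x k) = rec_nat (0::nat) (\<lambda>k r. if R x k then 1 else r) m" for x m
  proof (induction m)
    case (Suc m)
    have "of_bool (\<exists>k<Suc m. R x k) = (if R x m then 1::nat else of_bool (\<exists>k<m. R x k))"
      by (auto simp: less_Suc_eq)
    also have "\<dots> = rec_nat (0::nat) (\<lambda>k r. if R x k then 1 else r) (Suc m)"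
      unfolding Suc by simp
    finally show ?case .
  qed simp
  have R: "cpred A (\<lambda>z. R (pfst z) (pfst (psnd z)))"
    using cpred_subst[OF assms(1), of "\<lambda>z. prod_encode (pfst z, pfst (psnd z))"]
    by (simp add: comp_intros)
  show ?thesis unfolding cpred_def eq by (intro comp_intros assms R)
qed

lemma cpred_ball [comp_intros]:
  assumes "cpred A (\<lambda>z. R (pfst z) (psnd z))" "cfun A n"
  shows "cpred A (\<lambda>x. \<forall>k<n x. R x k)"
  using cpred_not[OF cpred_bex[OF cpred_not[OF assms(1)] assms(2)]] by simp

lemma cfun_search:
  assumes "cpred A (\<lambda>z. R (pfst z) (psnd z))"
  shows "\<exists>c. \<forall>x. run A c x = (if \<exists>m. R x m then Some (LEAST m. R x m) else None)"
proof -
  \<comment> \<open>\<open>Mu\<close> searches for the value 0, so the program must compute the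
    characteristic function of the negation.\<close>
  from cpred_not[OF assms] obtain c
    where c: "\<And>z. run A c z = Some (of_bool (\<not> R (pfst z) (psnd z)))"
    by (auto simp: cpred_def cfun_def)
  have *: "(R x m \<and> (\<forall>k<m. \<not> R x k)) \<longleftrightarrow> (\<exists>m. R x m) \<and> m = (LEAST m. R x m)" for x m
    by (metis LeastI not_less_Least linorder_neqE_nat)
  have "run A (Mu c) x = (if \<exists>m. R x m then Some (LEAST m. R x m) else None)" for x
  proof -
    have "(run A c (prod_encode (x, m)) = Some 0 \<and>
        (\<forall>k<m. \<exists>v. run A c (prod_encode (x, k)) = Some (Suc v))) \<longleftrightarrow>
        (\<exists>m. R x m) \<and> m = (LEAST m. R x m)" for m
      unfolding *[symmetric] by (auto simp: c)
    then show ?thesis unfolding run.simps Let_def by (auto intro!: Least_equality)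
  qed
  then show ?thesis by blast
qed

lemma cfun_LEAST:
  assumes "cpred A (\<lambda>z. R (pfst z) (psnd z))" "\<And>x. \<exists>m. R x m"
  shows "cfun A (\<lambda>x. LEAST m. R x m)"
  using cfun_search[OF assms(1)] assms(2) by (auto simp: cfun_def)

lemma cfun_div2 [comp_intros]: "cfun A f \<Longrightarrow> cfun A (\<lambda>x. f x div 2)"
proof -
  assume f: "cfun A f"
  \<comment> \<open>Rests on (y + 1) div 2 = y - y div 2, so halving needs only truncated
    subtraction.\<close>
  have half: "y div 2 = rec_nat 0 (\<lambda>m r. m - r) y" for y :: nat
  proof (induction y)
    case (Suc y)
    have "rec_nat 0 (\<lambda>m r. m - r) (Suc y) = y - y div 2" by (simp add: Suc)
    also have "\<dots> = Suc y div 2" by linarith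
    finally show ?case by simp
  qed simp
  show ?thesis unfolding half by (intro comp_intros f)
qed

lemma cpred_even [comp_intros]: "cfun A f \<Longrightarrow> cpred A (\<lambda>x. even (f x))"
proof -
  assume f: "cfun A f"
  have eq: "even y \<longleftrightarrow> y = 2 * (y div 2)" for y :: nat by presburger
  show ?thesis by (subst eq) (intro comp_intros f)
qed

lemma cpred_set_decode [comp_intros]:
  assumes "cfun A f" "cfun A g"
  shows "cpred A (\<lambda>x. f x \<in> set_decode (g x))"
proof -
  have eq: "y div 2 ^ n = ((\<lambda>y. y div 2) ^^ n) y" for y n :: nat
    by (induction n arbitrary: y) (simp_all add: div_mult2_eq funpow_Suc_right del: funpow.simps(2))
  show ?thesis unfolding set_decode_def mem_Collect_eq eq
    by (intro comp_intros cfun_funpow assms)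
qed

section \<open>Universality\<close>

abbreviation triple_encode :: "nat \<Rightarrow> nat \<Rightarrow> nat \<Rightarrow> nat" where
  "triple_encode e x y \<equiv> prod_encode (e, prod_encode (x, y))"

text \<open>
  Halting computations are witnessed by finite sets closed under backward steps: \<open>C\<close> consists of
  program codes and \<open>D\<close> of triples \<open>(e, x, y)\<close> meaning that program \<open>e\<close> maps \<open>x\<close> to \<open>y\<close>. The set \<open>C\<close> is
  needed since a recursion that stops at \<open>0\<close> never runs its step program. Oracle answers are left
  open in \<open>eval_step\<close> and checked by \<open>oracle_ok\<close>, which separates the positive from the negative
  queries.
\<close>

definition code_step :: "nat set \<Rightarrow> nat \<Rightarrow> bool" where
  "code_step C e \<longleftrightarrow> (pfst e < 5 \<and> psnd e = 0) \<or>
     (5 \<le> pfst e \<and> pfst e < 8 \<and> pfst (psnd e) \<in> C \<and> psnd (psnd e) \<in> C) \<or>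
     (pfst e = 8 \<and> psnd e \<in> C)"

definition eval_step :: "nat set \<Rightarrow> nat set \<Rightarrow> nat \<Rightarrow> nat \<Rightarrow> nat \<Rightarrow> bool" where
  "eval_step C D e x y \<longleftrightarrow>
     (e = prod_encode (0, 0) \<and> y = 0) \<or>
     (e = prod_encode (1, 0) \<and> y = Suc x) \<or>
     (e = prod_encode (2, 0) \<and> y = pfst x) \<or>
     (e = prod_encode (3, 0) \<and> y = psnd x) \<or>
     (e = prod_encode (4, 0) \<and> y \<le> 1) \<or>
     (pfst e = 5 \<and> triple_encode (pfst (psnd e)) x (pfst y) \<in> D \<and> triple_encode (psnd (psnd e)) x (psnd y) \<in> D) \<or>
     (pfst e = 6 \<and> (\<exists>z. triple_encode (psnd (psnd e)) x z \<in> D \<and> triple_encode (pfst (psnd e)) z y \<in> D)) \<or>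
     (pfst e = 7 \<and> psnd x = 0 \<and> psnd (psnd e) \<in> C \<and> triple_encode (pfst (psnd e)) (pfst x) y \<in> D) \<or>
     (pfst e = 7 \<and> 0 < psnd x \<and> (\<exists>r. triple_encode e (prod_encode (pfst x, psnd x - 1)) r \<in> D \<and>
        triple_encode (psnd (psnd e)) (prod_encode (pfst x, prod_encode (psnd x - 1, r))) y \<in> D)) \<or>
     (pfst e = 8 \<and> triple_encode (psnd e) (prod_encode (x, y)) 0 \<in> D \<and>
        (\<forall>k<y. \<exists>v. triple_encode (psnd e) (prod_encode (x, k)) (Suc v) \<in> D))"

definition derivation :: "nat set \<Rightarrow> nat set \<Rightarrow> bool" where
  "derivation C D \<longleftrightarrow> (\<forall>e\<in>C. code_step C e) \<and>
     (\<forall>t\<in>D. eval_step C D (pfst t) (pfst (psnd t)) (psnd (psnd t)))"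

definition oracle_ok :: "nat set \<Rightarrow> nat set \<Rightarrow> bool" where
  "oracle_ok A D \<longleftrightarrow>
     (\<forall>x. triple_encode (prod_encode (4, 0)) x 1 \<in> D \<longrightarrow> x \<in> A) \<and>
     (\<forall>x. triple_encode (prod_encode (4, 0)) x 0 \<in> D \<longrightarrow> x \<notin> A)"

text \<open>Each element of a backward-closed \<open>C\<close> unwinds to smaller elements of
  \<open>C\<close> until atomic programs are reached. This excludes numbers that code no program, on
  which \<open>part_fun\<close> diverges by definition.\<close>

lemma code_step_sound:
  assumes "\<forall>e\<in>C. code_step C e" "e \<in> C"
  shows "e \<in> range prog_encode"
  using assms(2)
proof (induction e rule: less_induct)
  case (less e)
  have e: "e = prod_encode (pfst e, psnd e)" by simp
  have "code_step C e" using assms(1) less.prems by blast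
  then consider "pfst e < 5" "psnd e = 0"
    | "5 \<le> pfst e" "pfst e < 8" "pfst (psnd e) \<in> C" "psnd (psnd e) \<in> C"
    | "pfst e = 8" "psnd e \<in> C"
    unfolding code_step_def by argo
  then show ?case
  proof cases
    case 1
    then have "pfst e \<in> {0, 1, 2, 3, 4}" by auto
    with 1 e have "e \<in> {prog_encode Zero, prog_encode Succ, prog_encode First,
        prog_encode Second, prog_encode Query}"
      by (auto simp del: prod_encode_pfst_psnd)
    then show ?thesis by blast
  next
    case 2
    then have "psnd e < e" by (intro psnd_less) simp
    then have "pfst (psnd e) < e" "psnd (psnd e) < e" using pfst_le psnd_le le_less_trans by blast+
    with 2 less.IH obtain c d where "pfst (psnd e) = prog_encode c" "psnd (psnd e) = prog_encode d"
      by blast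
    then have pe: "psnd e = prod_encode (prog_encode c, prog_encode d)"
      by (metis prod_encode_pfst_psnd)
    from 2 have "pfst e \<in> {5, 6, 7}" by auto
    with e pe have "e \<in> {prog_encode (Pair c d), prog_encode (Comp c d), prog_encode (Rec c d)}"
      by (auto simp del: prod_encode_pfst_psnd)
    then show ?thesis by blast
  next
    case 3
    then have "psnd e < e" by (intro psnd_less) simp
    with 3 less.IH obtain c where "psnd e = prog_encode c" by blast
    with e 3 have "e = prog_encode (Mu c)" by (auto simp del: prod_encode_pfst_psnd)
    then show ?thesis by blast
  qed
qed

text \<open>A triple is justified by triples with a smaller program code, except in the recursion
  step, which refers to the same code with a smaller counter. Hence an outer induction on the code
  and an inner one on the counter \<open>psnd x\<close>.\<close>

lemma derivation_sound:
  assumes "derivation C D" "oracle_ok A D" "triple_encode e x y \<in> D"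
  shows "\<exists>c. e = prog_encode c \<and> run A c x = Some y"
  using assms(3)
proof (induction e arbitrary: x y rule: less_induct)
  case (less e)
  have e: "e = prod_encode (pfst e, psnd e)" by simp
  have e2: "e = prod_encode (pfst e, prod_encode (pfst (psnd e), psnd (psnd e)))" by simp
  have smaller: "psnd e < e" "pfst (psnd e) < e" "psnd (psnd e) < e" if "0 < pfst e"
    using psnd_less[OF that] pfst_le[of "psnd e"] psnd_le[of "psnd e"] by auto
  have IH: "\<exists>c. e' = prog_encode c \<and> run A c x' = Some y'"
    if "triple_encode e' x' y' \<in> D" "0 < pfst e" "e' \<in> {psnd e, pfst (psnd e), psnd (psnd e)}" for e' x' y'
    using less.IH[OF _ that(1)] smaller[OF that(2)] that(3) by auto
  show ?case using less.prems
  proof (induction "psnd x" arbitrary: x y rule: less_induct)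
    case inner: less
    have "eval_step C D e x y"
      using assms(1) inner.prems unfolding derivation_def by fastforce
    then consider "e = prod_encode (0, 0)" "y = 0"
      | "e = prod_encode (1, 0)" "y = Suc x"
      | "e = prod_encode (2, 0)" "y = pfst x"
      | "e = prod_encode (3, 0)" "y = psnd x"
      | "e = prod_encode (4, 0)" "y \<le> 1"
      | "pfst e = 5" "triple_encode (pfst (psnd e)) x (pfst y) \<in> D" "triple_encode (psnd (psnd e)) x (psnd y) \<in> D"
      | z where "pfst e = 6" "triple_encode (psnd (psnd e)) x z \<in> D" "triple_encode (pfst (psnd e)) z y \<in> D"
      | "pfst e = 7" "psnd x = 0" "psnd (psnd e) \<in> C" "triple_encode (pfst (psnd e)) (pfst x) y \<in> D"
      | r where "pfst e = 7" "0 < psnd x" "triple_encode e (prod_encode (pfst x, psnd x - 1)) r \<in> D"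
          "triple_encode (psnd (psnd e)) (prod_encode (pfst x, prod_encode (psnd x - 1, r))) y \<in> D"
      | "pfst e = 8" "triple_encode (psnd e) (prod_encode (x, y)) 0 \<in> D"
          "\<forall>k<y. \<exists>v. triple_encode (psnd e) (prod_encode (x, k)) (Suc v) \<in> D"
      unfolding eval_step_def by (elim disjE exE conjE) (rule that, assumption+)+
    then show ?case
    proof cases
      case 1 then show ?thesis by (intro exI[of _ Zero]) simp
    next
      case 2 then show ?thesis by (intro exI[of _ Succ]) simp
    next
      case 3 then show ?thesis by (intro exI[of _ First]) (simp add: pfst_def)
    next
      case 4 then show ?thesis by (intro exI[of _ Second]) (simp add: psnd_def)
    next
      case 5
      \<comment> \<open>\<open>eval_step\<close> admits both answers 0 and 1;
        \<open>oracle_ok\<close> selects the true one.\<close>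
      then have "y = of_bool (x \<in> A)"
        using assms(2) inner.prems unfolding oracle_ok_def le_Suc_eq One_nat_def by auto
      with 5 show ?thesis by (intro exI[of _ Query]) simp
    next
      case 6
      from IH[OF 6(2)] IH[OF 6(3)] 6(1) obtain c d where
        "pfst (psnd e) = prog_encode c" "run A c x = Some (pfst y)"
        "psnd (psnd e) = prog_encode d" "run A d x = Some (psnd y)"
        by auto
      with e2 6 show ?thesis by (intro exI[of _ "Pair c d"]) (simp del: prod_encode_eq)
    next
      case (7 z)
      from IH[OF 7(2)] IH[OF 7(3)] 7(1) obtain c d where
        "pfst (psnd e) = prog_encode c" "run A c z = Some y"
        "psnd (psnd e) = prog_encode d" "run A d x = Some z"
        by auto
      with e2 7 show ?thesis by (intro exI[of _ "Comp c d"]) (simp del: prod_encode_eq)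
    next
      case 8
      from 8(3) assms(1) code_step_sound obtain d where d: "psnd (psnd e) = prog_encode d"
        unfolding derivation_def by blast
      from IH[OF 8(4)] 8(1) obtain c where
        "pfst (psnd e) = prog_encode c" "run A c (pfst x) = Some y"
        by auto
      with e2 8 d show ?thesis
        by (intro exI[of _ "Rec c d"]) (simp del: prod_encode_eq add: prod_decode_eq_pair)
    next
      case (9 r)
      from inner.hyps[OF _ 9(3)] 9(2) obtain p where
        p: "e = prog_encode p" "run A p (prod_encode (pfst x, psnd x - 1)) = Some r"
        by auto
      from IH[OF 9(4)] 9(1) obtain d where
        d: "psnd (psnd e) = prog_encode d"
        "run A d (prod_encode (pfst x, prod_encode (psnd x - 1, r))) = Some y"
        by auto
      \<comment> \<open>The inner hypothesis shows that \<open>e\<close> codes some program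
        \<open>p\<close>; the tag 7 identifies it as a recursion.\<close>
      from p(1) 9(1) d(1) obtain c where c: "p = Rec c d"
        by (cases p) auto
      obtain m where "psnd x = Suc m" using 9(2) gr0_implies_Suc by blast
      with p c d show ?thesis
        by (intro exI[of _ p]) (simp add: prod_decode_eq_pair)
    next
      case 10
      have IH': "\<exists>c. psnd e = prog_encode c \<and> run A c x' = Some y'" if "triple_encode (psnd e) x' y' \<in> D" for x' y'
        using IH[OF that] 10(1) by simp
      from IH'[OF 10(2)] obtain c where
        c: "psnd e = prog_encode c" "run A c (prod_encode (x, y)) = Some 0" by blast
      have pos: "\<forall>k<y. \<exists>v. run A c (prod_encode (x, k)) = Some (Suc v)"
      proof (intro allI impI)
        fix k assume "k < y"
        with 10(3) obtain v where "triple_encode (psnd e) (prod_encode (x, k)) (Suc v) \<in> D" by blast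
        from IH'[OF this] c(1) show "\<exists>v. run A c (prod_encode (x, k)) = Some (Suc v)" by auto
      qed
      have uniq: "m = y" if "run A c (prod_encode (x, m)) = Some 0"
        "\<forall>k<m. \<exists>v. run A c (prod_encode (x, k)) = Some (Suc v)" for m
        using that c(2) pos by (metis linorder_neqE_nat nat.distinct(1) option.inject)
      define Q where "Q = (\<lambda>m. run A c (prod_encode (x, m)) = Some 0 \<and>
        (\<forall>k<m. \<exists>v. run A c (prod_encode (x, k)) = Some (Suc v)))"
      have "Q y" "\<And>m. Q m \<Longrightarrow> m = y" using c(2) pos uniq unfolding Q_def by blast+
      then have "(LEAST m. Q m) = y" by (metis LeastI)
      with \<open>Q y\<close> have "run A (Mu c) x = Some y"
        unfolding run.simps Let_def Q_def by auto
      with e 10(1) c(1) show ?thesis by (intro exI[of _ "Mu c"]) (simp del: prod_encode_pfst_psnd)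
    qed
  qed
qed

section \<open>Finite derivations for halting computations\<close>

primrec subcodes :: "prog \<Rightarrow> nat set" where
  "subcodes Zero = {prog_encode Zero}"
| "subcodes Succ = {prog_encode Succ}"
| "subcodes First = {prog_encode First}"
| "subcodes Second = {prog_encode Second}"
| "subcodes Query = {prog_encode Query}"
| "subcodes (Pair c d) = insert (prog_encode (Pair c d)) (subcodes c \<union> subcodes d)"
| "subcodes (Comp c d) = insert (prog_encode (Comp c d)) (subcodes c \<union> subcodes d)"
| "subcodes (Rec c d) = insert (prog_encode (Rec c d)) (subcodes c \<union> subcodes d)"
| "subcodes (Mu c) = insert (prog_encode (Mu c)) (subcodes c)"

lemma finite_subcodes: "finite (subcodes c)"
  by (induction c) auto

lemma self_in_subcodes: "prog_encode c \<in> subcodes c"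
  by (cases c) auto

lemma code_step_mono: "code_step C e \<Longrightarrow> C \<subseteq> C' \<Longrightarrow> code_step C' e"
  unfolding code_step_def by blast

lemma code_step_subcodes: "\<forall>e\<in>subcodes c. code_step (subcodes c) e"
proof (induction c)
  case (Pair c d)
  then show ?case using self_in_subcodes[of c] self_in_subcodes[of d]
    by (auto intro: code_step_mono) (simp add: code_step_def)
next
  case (Comp c d)
  then show ?case using self_in_subcodes[of c] self_in_subcodes[of d]
    by (auto intro: code_step_mono) (simp add: code_step_def)
next
  case (Rec c d)
  then show ?case using self_in_subcodes[of c] self_in_subcodes[of d]
    by (auto intro: code_step_mono) (simp add: code_step_def)
next
  case (Mu c)
  then show ?case using self_in_subcodes[of c]
    by (auto intro: code_step_mono) (simp add: code_step_def)
qed (simp_all add: code_step_def)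

text \<open>\<open>D\<close> occurs only positively in \<open>eval_step\<close>; this is what allows
  derivations over a common \<open>C\<close> to be united.\<close>

lemma eval_step_mono:
  assumes "eval_step C D e x y" "D \<subseteq> D'"
  shows "eval_step C D' e x y"
  using assms(1) unfolding eval_step_def
  by (elim disj_forward conj_forward ex_forward all_forward imp_forward)
     (assumption | erule subsetD[OF assms(2)])+

lemma derivation_UN:
  "(\<And>i. i \<in> I \<Longrightarrow> derivation C (D i)) \<Longrightarrow> \<forall>e\<in>C. code_step C e \<Longrightarrow> derivation C (\<Union>i\<in>I. D i)"
  unfolding derivation_def by (blast intro: eval_step_mono)

lemma derivation_Un: "derivation C D \<Longrightarrow> derivation C D' \<Longrightarrow> derivation C (D \<union> D')"
  unfolding derivation_def by (blast intro: eval_step_mono)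

lemma derivation_insert:
  "derivation C D \<Longrightarrow> eval_step C D e x y \<Longrightarrow> derivation C (insert (triple_encode e x y) D)"
  unfolding derivation_def by (auto intro: eval_step_mono)

lemma oracle_ok_Un: "oracle_ok A D \<Longrightarrow> oracle_ok A D' \<Longrightarrow> oracle_ok A (D \<union> D')"
  unfolding oracle_ok_def by blast

lemma oracle_ok_insert:
  "oracle_ok A D \<Longrightarrow> e \<noteq> prod_encode (4, 0) \<Longrightarrow> oracle_ok A (insert (triple_encode e x y) D)"
  unfolding oracle_ok_def by auto

text \<open>Derivations of the subcomputations are united and the concluding triple is added.
  \<open>C\<close> is fixed as a set containing all subprograms, so only the \<open>D\<close> parts
  have to be merged. \<open>oracle_ok\<close> survives because query triples arise only from true
  oracle answers.\<close>

lemma derivation_complete: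
  assumes "\<forall>e\<in>C. code_step C e"
  shows "subcodes c \<subseteq> C \<Longrightarrow> run A c x = Some y \<Longrightarrow>
    \<exists>D. finite D \<and> derivation C D \<and> oracle_ok A D \<and> triple_encode (prog_encode c) x y \<in> D"
proof (induction c arbitrary: x y)
  case Zero
  then show ?case using assms
    by (intro exI[of _ "{triple_encode (prog_encode Zero) x y}"])
       (auto simp: derivation_def eval_step_def oracle_ok_def)
next
  case Succ
  then show ?case using assms
    by (intro exI[of _ "{triple_encode (prog_encode Succ) x y}"])
       (auto simp: derivation_def eval_step_def oracle_ok_def)
next
  case First
  then show ?case using assms
    by (intro exI[of _ "{triple_encode (prog_encode First) x y}"])
       (auto simp: derivation_def eval_step_def oracle_ok_def pfst_def)
next
  case Second
  then show ?case using assms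
    by (intro exI[of _ "{triple_encode (prog_encode Second) x y}"])
       (auto simp: derivation_def eval_step_def oracle_ok_def psnd_def)
next
  case Query
  then show ?case using assms
    by (intro exI[of _ "{triple_encode (prog_encode Query) x y}"])
       (auto simp: derivation_def eval_step_def oracle_ok_def split: if_splits)
next
  case (Pair c d)
  from Pair.prems obtain u v where uv: "run A c x = Some u" "run A d x = Some v"
    "y = prod_encode (u, v)" by (auto simp: bind_eq_Some_conv)
  from Pair uv obtain D D' where
    D: "finite D" "derivation C D" "oracle_ok A D" "triple_encode (prog_encode c) x u \<in> D" and
    D': "finite D'" "derivation C D'" "oracle_ok A D'" "triple_encode (prog_encode d) x v \<in> D'"
    by (metis Un_subset_iff insert_subset subcodes.simps(6))
  show ?case
    by (rule exI[of _ "insert (triple_encode (prog_encode (Pair c d)) x y) (D \<union> D')"])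
       (use D D' uv in \<open>auto intro!: derivation_insert derivation_Un oracle_ok_insert oracle_ok_Un
          simp: eval_step_def\<close>)
next
  case (Comp c d)
  from Comp.prems obtain z where z: "run A d x = Some z" "run A c z = Some y"
    by (auto simp: bind_eq_Some_conv)
  from Comp z obtain D D' where
    D: "finite D" "derivation C D" "oracle_ok A D" "triple_encode (prog_encode c) z y \<in> D" and
    D': "finite D'" "derivation C D'" "oracle_ok A D'" "triple_encode (prog_encode d) x z \<in> D'"
    by (metis Un_subset_iff insert_subset subcodes.simps(7))
  have "eval_step C (D \<union> D') (prog_encode (Comp c d)) x y"
    using D D' unfolding eval_step_def by auto
  then show ?case
    by (intro exI[of _ "insert (triple_encode (prog_encode (Comp c d)) x y) (D \<union> D')"])
       (use D D' in \<open>auto intro!: derivation_insert derivation_Un oracle_ok_insert oracle_ok_Un\<close>)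
next
  case (Rec c d)
  have dC: "prog_encode d \<in> C" using Rec.prems(1) self_in_subcodes[of d] by auto
  have "\<exists>D. finite D \<and> derivation C D \<and> oracle_ok A D \<and>
      triple_encode (prog_encode (Rec c d)) (prod_encode (a, n)) y \<in> D"
    if "run A (Rec c d) (prod_encode (a, n)) = Some y" for a n y
    using that
  proof (induction n arbitrary: y)
    case 0
    then have "run A c a = Some y" by simp
    with Rec.IH(1)[of a y] Rec.prems(1) obtain D where
      D: "finite D" "derivation C D" "oracle_ok A D" "triple_encode (prog_encode c) a y \<in> D" by auto
    have "eval_step C D (prog_encode (Rec c d)) (prod_encode (a, 0)) y"
      using D dC unfolding eval_step_def by auto
    then show ?case
      by (intro exI[of _ "insert (triple_encode (prog_encode (Rec c d)) (prod_encode (a, 0)) y) D"])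
         (use D in \<open>auto intro!: derivation_insert oracle_ok_insert\<close>)
  next
    case (Suc n)
    from Suc.prems obtain r where r: "run A (Rec c d) (prod_encode (a, n)) = Some r"
      "run A d (prod_encode (a, prod_encode (n, r))) = Some y"
      by (auto simp: bind_eq_Some_conv)
    from Suc.IH[OF r(1)] Rec.IH(2)[OF _ r(2)] Rec.prems(1) obtain D D' where
      D: "finite D" "derivation C D" "oracle_ok A D"
        "triple_encode (prog_encode (Rec c d)) (prod_encode (a, n)) r \<in> D" and
      D': "finite D'" "derivation C D'" "oracle_ok A D'"
        "triple_encode (prog_encode d) (prod_encode (a, prod_encode (n, r))) y \<in> D'"
      by auto
    have "eval_step C (D \<union> D') (prog_encode (Rec c d)) (prod_encode (a, Suc n)) y"
      using D D' unfolding eval_step_def by auto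
    then show ?case
      by (intro exI[of _ "insert (triple_encode (prog_encode (Rec c d)) (prod_encode (a, Suc n)) y) (D \<union> D')"])
         (use D D' in \<open>auto intro!: derivation_insert derivation_Un oracle_ok_insert oracle_ok_Un\<close>)
  qed
  from this[of "pfst x" "psnd x"] Rec.prems(2) show ?case by simp
next
  case (Mu c)
  define Q where "Q = (\<lambda>m. run A c (prod_encode (x, m)) = Some 0 \<and>
      (\<forall>k<m. \<exists>v. run A c (prod_encode (x, k)) = Some (Suc v)))"
  from Mu.prems(2) have "\<exists>m. Q m" "y = (LEAST m. Q m)"
    by (auto simp: Let_def Q_def split: if_splits)
  then have "Q y" by (metis LeastI_ex)
  then have "\<forall>k\<le>y. \<exists>v. run A c (prod_encode (x, k)) = Some v \<and> (v = 0 \<longleftrightarrow> k = y)"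
    unfolding Q_def by (metis le_eq_less_or_eq nat.distinct(1))
  then obtain v where v: "\<And>k. k \<le> y \<Longrightarrow> run A c (prod_encode (x, k)) = Some (v k)"
    "\<And>k. k \<le> y \<Longrightarrow> v k = 0 \<longleftrightarrow> k = y" by metis
  have "\<forall>k\<in>{..y}. \<exists>D. finite D \<and> derivation C D \<and> oracle_ok A D \<and>
      triple_encode (prog_encode c) (prod_encode (x, k)) (v k) \<in> D"
    using Mu.IH Mu.prems(1) v(1) by auto
  then obtain D where D: "\<And>k. k \<le> y \<Longrightarrow> finite (D k) \<and> derivation C (D k) \<and> oracle_ok A (D k) \<and>
      triple_encode (prog_encode c) (prod_encode (x, k)) (v k) \<in> D k"
    by (metis atMost_iff)
  define E where "E = (\<Union>k\<in>{..y}. D k)"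
  have E: "finite E" "derivation C E" "oracle_ok A E"
    using D assms by (auto simp: E_def oracle_ok_def intro!: derivation_UN)
  have inE: "triple_encode (prog_encode c) (prod_encode (x, k)) (v k) \<in> E" if "k \<le> y" for k
    using D that unfolding E_def by blast
  have "\<exists>w. triple_encode (prog_encode c) (prod_encode (x, k)) (Suc w) \<in> E" if "k < y" for k
    using inE[of k] v(2)[of k] that by (cases "v k") auto
  moreover have "triple_encode (prog_encode c) (prod_encode (x, y)) 0 \<in> E"
    using inE[of y] v(2)[of y] by simp
  ultimately have "eval_step C E (prog_encode (Mu c)) x y"
    unfolding eval_step_def by auto
  then show ?case
    by (intro exI[of _ "insert (triple_encode (prog_encode (Mu c)) x y) E"])
       (use E in \<open>auto intro!: derivation_insert oracle_ok_insert\<close>)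
qed

lemma part_fun_prog_encode [simp]: "part_fun A (prog_encode c) = run A c"
proof -
  have "inj prog_encode" by (simp add: inj_def)
  then show ?thesis by (simp add: part_fun_def)
qed

text \<open>Kleene's normal form: an existential quantifier over a matrix decidable in
  \<open>A\<close>, uniformly in the index. The oracle enters through \<open>oracle_ok\<close>
  alone, which is exploited for the jump.\<close>

theorem part_fun_iff_derivation:
  "part_fun A e x = Some y \<longleftrightarrow> (\<exists>C D. derivation (set_decode C) (set_decode D) \<and>
     triple_encode e x y \<in> set_decode D \<and> oracle_ok A (set_decode D))" (is "?L \<longleftrightarrow> ?R")
proof
  assume ?L
  then obtain c where c: "e = prog_encode c" "run A c x = Some y"
    by (metis image_iff option.distinct(1) part_fun_def part_fun_prog_encode)
  from derivation_complete[OF code_step_subcodes subset_refl c(2)] obtain D where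
    "finite D" "derivation (subcodes c) D" "oracle_ok A D" "triple_encode e x y \<in> D" by (auto simp: c)
  then show ?R
    by (intro exI[of _ "set_encode (subcodes c)"] exI[of _ "set_encode D"])
       (simp add: finite_subcodes)
next
  assume ?R
  then show ?L using derivation_sound by fastforce
qed

section \<open>Decidability of the derivation predicate\<close>

lemma mem_set_decode_less: "n \<in> set_decode C \<Longrightarrow> n < C"
proof -
  assume "n \<in> set_decode C"
  then have "C div 2 ^ n \<noteq> 0" unfolding set_decode_def by (auto dest: odd_pos)
  then have "2 ^ n \<le> C" using div_less by (metis not_less)
  then show ?thesis using less_exp[of n] by linarith
qed

lemma triple_mem_less:
  assumes "triple_encode a x z \<in> set_decode D"
  shows "x < D" "z < D"
  using mem_set_decode_less[OF assms] le_prod_encode_2[of "prod_encode (x, z)" a]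
    le_prod_encode_1[of x z] le_prod_encode_2[of z x] by auto

lemma cpred_eval_step [comp_intros]:
  assumes [THEN cfun_comp, comp_intros]: "cfun A C" "cfun A D" "cfun A e" "cfun A x" "cfun A y"
  shows "cpred A (\<lambda>w. eval_step (set_decode (C w)) (set_decode (D w)) (e w) (x w) (y w))"
proof -
  \<comment> \<open>The witnesses are components of triples in the coded set, and members of a coded
    finite set are below its code; so the code bounds the quantifiers.\<close>
  have b1: "(\<exists>z. triple_encode a v z \<in> set_decode S \<and> Q z) \<longleftrightarrow> (\<exists>z<S. triple_encode a v z \<in> set_decode S \<and> Q z)"
    for a v S Q using triple_mem_less by blast
  have b2: "(\<exists>z. triple_encode a v (Suc z) \<in> set_decode S) \<longleftrightarrow> (\<exists>z<S. triple_encode a v (Suc z) \<in> set_decode S)"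
    for a v S using triple_mem_less Suc_lessD by blast
  have id: "cfun A C" "cfun A D" "cfun A e" "cfun A x" "cfun A y" by (fact assms)+
  show ?thesis unfolding eval_step_def b1 b2
    by (intro comp_intros id)
qed

lemma cpred_derivation [comp_intros]:
  assumes "cfun A C" "cfun A D"
  shows "cpred A (\<lambda>w. derivation (set_decode (C w)) (set_decode (D w)))"
proof -
  have b: "(\<forall>t\<in>set_decode S. Q t) \<longleftrightarrow> (\<forall>t<S. t \<in> set_decode S \<longrightarrow> Q t)" for S Q
    using mem_set_decode_less by blast
  show ?thesis unfolding derivation_def b unfolding code_step_def
    by (intro comp_intros assms assms[THEN cfun_comp])
qed

lemma oracle_ok_set_decode:
  "oracle_ok A (set_decode D) \<longleftrightarrow>
     (\<forall>x<D. triple_encode (prod_encode (4, 0)) x 1 \<in> set_decode D \<longrightarrow> x \<in> A) \<and>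
     (\<forall>x<D. \<not> (triple_encode (prod_encode (4, 0)) x 0 \<in> set_decode D \<and> x \<in> A))"
  unfolding oracle_ok_def using triple_mem_less by blast

lemma cpred_oracle_ok [comp_intros]:
  assumes "cfun A D"
  shows "cpred A (\<lambda>w. oracle_ok A (set_decode (D w)))"
  unfolding oracle_ok_set_decode
  by (intro comp_intros assms assms[THEN cfun_comp] cpred_oracle)

section \<open>Computably enumerable predicates\<close>

text \<open>A Sigma_1 form with decidable matrix in place of the domain of a program: closure under
  connectives, projection and bounded quantification becomes a regrouping of witnesses.
  \<open>ce_run\<close> and \<open>ce_smn\<close> lead back to programs and indices.\<close>

definition ce :: "nat set \<Rightarrow> (nat \<Rightarrow> bool) \<Rightarrow> bool" where
  "ce A R \<longleftrightarrow> (\<exists>S. cpred A S \<and> (\<forall>x. R x \<longleftrightarrow> (\<exists>m. S (prod_encode (x, m)))))"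

named_theorems ce_intros

lemma ceI: "cpred A (\<lambda>z. S (pfst z) (psnd z)) \<Longrightarrow> (\<And>x. R x \<longleftrightarrow> (\<exists>m. S x m)) \<Longrightarrow> ce A R"
  unfolding ce_def by (rule exI[of _ "\<lambda>z. S (pfst z) (psnd z)"]) simp

lemma ceE:
  assumes "ce A R"
  obtains S where "\<And>f g. cfun A f \<Longrightarrow> cfun A g \<Longrightarrow> cpred A (\<lambda>x. S (f x) (g x))"
    "\<And>x. R x \<longleftrightarrow> (\<exists>m. S x m)"
proof -
  from assms obtain S where S: "cpred A S" "\<And>x. R x \<longleftrightarrow> (\<exists>m. S (prod_encode (x, m)))"
    unfolding ce_def by blast
  show thesis
    by (rule that[of "\<lambda>x m. S (prod_encode (x, m))"])
       (use S in \<open>auto intro!: cpred_subst[OF S(1)] comp_intros\<close>)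
qed

lemma ce_cpred: "cpred A R \<Longrightarrow> ce A R"
  by (rule ceI[of _ "\<lambda>x m. R x"]) (auto intro: cpred_subst[OF _ cfun_pfst[OF cfun_id]])

lemmas [ce_intros] = cpred_const[THEN ce_cpred] cpred_less[THEN ce_cpred] cpred_le[THEN ce_cpred]
  cpred_eq[THEN ce_cpred] cpred_set_decode[THEN ce_cpred]

lemma ce_subst: "ce A R \<Longrightarrow> cfun A f \<Longrightarrow> ce A (\<lambda>x. R (f x))"
proof (erule ceE)
  fix S assume f: "cfun A f" and S: "\<And>f g. cfun A f \<Longrightarrow> cfun A g \<Longrightarrow> cpred A (\<lambda>x. S (f x) (g x))"
    and R: "\<And>x. R x \<longleftrightarrow> (\<exists>m. S x m)"
  show "ce A (\<lambda>x. R (f x))"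
    by (rule ceI[of _ "\<lambda>x m. S (f x) m"]) (auto intro!: S comp_intros cfun_comp[OF f] simp: R)
qed

lemma ce_subst2:
  "ce A (\<lambda>z. R (pfst z) (psnd z)) \<Longrightarrow> cfun A f \<Longrightarrow> cfun A g \<Longrightarrow> ce A (\<lambda>x. R (f x) (g x))"
  by (drule ce_subst[of _ _ "\<lambda>x. prod_encode (f x, g x)"]) (auto intro: cfun_prod_encode)

lemma ce_and [ce_intros]: "ce A P \<Longrightarrow> ce A Q \<Longrightarrow> ce A (\<lambda>x. P x \<and> Q x)"
proof (elim ceE)
  fix S T assume S: "\<And>f g. cfun A f \<Longrightarrow> cfun A g \<Longrightarrow> cpred A (\<lambda>x. S (f x) (g x))"
    and T: "\<And>f g. cfun A f \<Longrightarrow> cfun A g \<Longrightarrow> cpred A (\<lambda>x. T (f x) (g x))"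
    and PQ: "\<And>x. P x \<longleftrightarrow> (\<exists>m. S x m)" "\<And>x. Q x \<longleftrightarrow> (\<exists>m. T x m)"
  have "(\<exists>m. S x m) \<and> (\<exists>m. T x m) \<longleftrightarrow> (\<exists>m. S x (pfst m) \<and> T x (psnd m))" for x
    by (metis pfst_prod_encode psnd_prod_encode)
  then show "ce A (\<lambda>x. P x \<and> Q x)" unfolding PQ
    by (intro ceI[of _ "\<lambda>x m. S x (pfst m) \<and> T x (psnd m)"] S T comp_intros) auto
qed

lemma ce_or [ce_intros]: "ce A P \<Longrightarrow> ce A Q \<Longrightarrow> ce A (\<lambda>x. P x \<or> Q x)"
proof (elim ceE)
  fix S T assume S: "\<And>f g. cfun A f \<Longrightarrow> cfun A g \<Longrightarrow> cpred A (\<lambda>x. S (f x) (g x))"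
    and T: "\<And>f g. cfun A f \<Longrightarrow> cfun A g \<Longrightarrow> cpred A (\<lambda>x. T (f x) (g x))"
    and PQ: "\<And>x. P x \<longleftrightarrow> (\<exists>m. S x m)" "\<And>x. Q x \<longleftrightarrow> (\<exists>m. T x m)"
  show "ce A (\<lambda>x. P x \<or> Q x)" unfolding PQ
    by (intro ceI[of _ "\<lambda>x m. S x m \<or> T x m"] S T comp_intros) auto
qed

lemma ce_ex [ce_intros]: "ce A (\<lambda>z. R (pfst z) (psnd z)) \<Longrightarrow> ce A (\<lambda>x. \<exists>k. R x k)"
proof (elim ceE)
  fix S assume S: "\<And>f g. cfun A f \<Longrightarrow> cfun A g \<Longrightarrow> cpred A (\<lambda>x. S (f x) (g x))"
    and R: "\<And>z. R (pfst z) (psnd z) \<longleftrightarrow> (\<exists>m. S z m)"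
  have "(\<exists>k. R x k) \<longleftrightarrow> (\<exists>m. S (prod_encode (x, pfst m)) (psnd m))" for x
    using R[of "prod_encode (x, _)"] by (metis pfst_prod_encode psnd_prod_encode)
  then show "ce A (\<lambda>x. \<exists>k. R x k)"
    by (intro ceI[of _ "\<lambda>x m. S (prod_encode (x, pfst m)) (psnd m)"] S comp_intros)
qed

lemma ce_ball [ce_intros]:
  assumes "ce A (\<lambda>z. R (pfst z) (psnd z))" "cfun A n"
  shows "ce A (\<lambda>x. \<forall>k<n x. R x k)"
  using assms(1)
proof (rule ceE)
  fix S assume S: "\<And>f g. cfun A f \<Longrightarrow> cfun A g \<Longrightarrow> cpred A (\<lambda>x. S (f x) (g x))"
    and R: "\<And>z. R (pfst z) (psnd z) \<longleftrightarrow> (\<exists>m. S z m)"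
  have R': "R x k \<longleftrightarrow> (\<exists>m. S (prod_encode (x, k)) m)" for x k
    using R[of "prod_encode (x, k)"] by simp
  \<comment> \<open>Collection: finitely many witnesses have a common bound, which moves the
    unbounded quantifier to the front.\<close>
  have "(\<forall>k<n x. R x k) \<longleftrightarrow> (\<exists>m. \<forall>k<n x. \<exists>j<m. S (prod_encode (x, k)) j)" for x
  proof
    assume "\<forall>k<n x. R x k"
    then obtain j where j: "\<And>k. k < n x \<Longrightarrow> S (prod_encode (x, k)) (j k)" unfolding R' by metis
    have "j k < Suc (Max (j ` {..<n x}))" if "k < n x" for k
      using that by (auto intro!: le_imp_less_Suc Max_ge)
    with j show "\<exists>m. \<forall>k<n x. \<exists>j<m. S (prod_encode (x, k)) j" by blast
  qed (use R' in blast)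
  then show "ce A (\<lambda>x. \<forall>k<n x. R x k)"
    by (intro ceI[of _ "\<lambda>x m. \<forall>k<n x. \<exists>j<m. S (prod_encode (x, k)) j"] S comp_intros
        assms(2)[THEN cfun_comp])
qed

lemma ce_imp [ce_intros]: "cpred A P \<Longrightarrow> ce A Q \<Longrightarrow> ce A (\<lambda>x. P x \<longrightarrow> Q x)"
  unfolding imp_conv_disj by (intro ce_or ce_cpred[OF cpred_not])

lemma ce_part_fun [ce_intros]:
  assumes "cfun A e" "cfun A x" "cfun A y"
  shows "ce A (\<lambda>w. part_fun A (e w) (x w) = Some (y w))"
  unfolding part_fun_iff_derivation
  by (intro ce_intros ce_cpred comp_intros assms assms[THEN cfun_comp])

lemma ce_ce_set [ce_intros]:
  assumes "cfun A x" "cfun A e"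
  shows "ce A (\<lambda>w. x w \<in> ce_set A (e w))"
  unfolding ce_set_def domIff not_None_eq
  by (intro ce_intros comp_intros assms assms[THEN cfun_comp])

section \<open>Change of oracle, effective choice, the s-m-n theorem, the jump\<close>

primrec drop_query :: "prog \<Rightarrow> prog" where
  "drop_query Zero = Zero"
| "drop_query Succ = Succ"
| "drop_query First = First"
| "drop_query Second = Second"
| "drop_query Query = Zero"
| "drop_query (Pair c d) = Pair (drop_query c) (drop_query d)"
| "drop_query (Comp c d) = Comp (drop_query c) (drop_query d)"
| "drop_query (Rec c d) = Rec (drop_query c) (drop_query d)"
| "drop_query (Mu c) = Mu (drop_query c)"

text \<open>\<open>Zero\<close> returns what \<open>Query\<close> returns for the empty oracle, so
  computations without oracle can be repeated relative to any oracle.\<close>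

lemma run_drop_query: "run A (drop_query c) = run {} c"
  by (induction c) simp_all

lemma cfun_mono: "cfun {} f \<Longrightarrow> cfun A f"
  unfolding cfun_def by (metis run_drop_query)

lemma cpred_mono: "cpred {} R \<Longrightarrow> cpred A R"
  unfolding cpred_def by (rule cfun_mono)

lemma ce_mono: "ce {} R \<Longrightarrow> ce A R"
  unfolding ce_def using cpred_mono by blast

lemma computable_fun_iff: "computable_fun f \<longleftrightarrow> cfun {} f"
proof
  assume "computable_fun f"
  then obtain e where e: "\<And>x. part_fun {} e x = Some (f x)" by (auto simp: computable_fun_def)
  then have "e \<in> range prog_encode" by (metis option.distinct(1) part_fun_def)
  then obtain c where "e = prog_encode c" by blast
  with e show "cfun {} f" unfolding cfun_def by (intro exI[of _ c]) simp
next
  assume "cfun {} f"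
  then show "computable_fun f" unfolding cfun_def computable_fun_def
    by (metis part_fun_prog_encode)
qed

lemma ce_run: "ce A R \<Longrightarrow> \<exists>c. \<forall>x. R x \<longleftrightarrow> run A c x \<noteq> None"
proof (elim ceE)
  fix S assume S: "\<And>f g. cfun A f \<Longrightarrow> cfun A g \<Longrightarrow> cpred A (\<lambda>x. S (f x) (g x))"
    and R: "\<And>x. R x \<longleftrightarrow> (\<exists>m. S x m)"
  from cfun_search[OF S[OF cfun_pfst[OF cfun_id] cfun_psnd[OF cfun_id]]]
  show "\<exists>c. \<forall>x. R x \<longleftrightarrow> run A c x \<noteq> None" unfolding R by (metis option.distinct(1))
qed

text \<open>A search over pairs of a candidate and its witness halts on every input, and the
  candidate is read off the least pair. The later searches for rationals and thresholds go through
  this lemma.\<close>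

lemma cfun_choice:
  assumes "ce A (\<lambda>z. R (pfst z) (psnd z))" "\<And>x. \<exists>y. R x y"
  shows "\<exists>f. cfun A f \<and> (\<forall>x. R x (f x))"
  using assms(1)
proof (rule ceE)
  fix S assume S: "\<And>f g. cfun A f \<Longrightarrow> cfun A g \<Longrightarrow> cpred A (\<lambda>x. S (f x) (g x))"
    and R: "\<And>z. R (pfst z) (psnd z) \<longleftrightarrow> (\<exists>m. S z m)"
  define T where "T = (\<lambda>x m. S (prod_encode (x, pfst m)) (psnd m))"
  have T: "cpred A (\<lambda>z. T (pfst z) (psnd z))" unfolding T_def by (intro S comp_intros)
  have R': "R x y \<longleftrightarrow> (\<exists>m. T x (prod_encode (y, m)))" for x y
    using R[of "prod_encode (x, y)"] by (simp add: T_def)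
  then have ex: "\<exists>m. T x m" for x using assms(2) by blast
  have "R x (pfst (LEAST m. T x m))" for x
    unfolding R' by (metis LeastI_ex ex prod_encode_pfst_psnd)
  with cfun_pfst[OF cfun_LEAST[OF T ex]] show ?thesis by blast
qed

lemma ce_enumeration:
  assumes "ce A R" "R x0"
  obtains w where "cfun A w" "\<And>x. R x \<longleftrightarrow> x \<in> range w"
  using assms(1)
proof (rule ceE)
  fix S assume S: "\<And>f g. cfun A f \<Longrightarrow> cfun A g \<Longrightarrow> cpred A (\<lambda>x. S (f x) (g x))"
    and R: "\<And>x. R x \<longleftrightarrow> (\<exists>m. S x m)"
  \<comment> \<open>Pairs that witness nothing are sent to the given element \<open>x0\<close>,
    which keeps the enumeration total.\<close>
  let ?w = "\<lambda>m. if S (pfst m) (psnd m) then pfst m else x0"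
  have "R x \<longleftrightarrow> x \<in> range ?w" for x
  proof
    assume "R x"
    then obtain m where "S x m" using R by blast
    then have "x = ?w (prod_encode (x, m))" by simp
    then show "x \<in> range ?w" by blast
  qed (use R assms(2) in auto)
  then show thesis by (intro that[of ?w]) (intro S comp_intros)
qed

text \<open>The parameter is hard-wired by a constant program whose code is primitive recursive in
  \<open>k\<close>. The transformation never looks at the oracle, so \<open>h\<close> is computable
  outright, as \<open>uniformly\<close> demands even for notions relative to an oracle.\<close>

lemma smn:
  "\<exists>h. cfun {} h \<and> (\<forall>A k x. part_fun A (h k) x = run A c (prod_encode (k, x)))"
proof -
  define const where "const = (\<lambda>k. (Comp Succ ^^ k) Zero)"
  have run_const: "run A (const k) x = Some k" for A k x
    by (induction k) (simp_all add: const_def)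
  have enc: "prog_encode (const k) =
      rec_nat (prog_encode Zero) (\<lambda>_ r. prod_encode (6, prod_encode (prog_encode Succ, r))) k" for k
    by (induction k) (simp_all add: const_def)
  define h where "h = (\<lambda>k. prog_encode (Comp c (Pair (const k) (Pair First Second))))"
  have "cfun {} h" unfolding h_def prog_encode.simps(6,7) enc by (intro comp_intros)
  moreover have "part_fun A (h k) x = run A c (prod_encode (k, x))" for A k x
    unfolding h_def part_fun_prog_encode by (simp add: run_const)
  ultimately show ?thesis by blast
qed

lemma ce_smn:
  assumes "ce A (\<lambda>z. R (pfst z) (psnd z))"
  shows "\<exists>h. cfun {} h \<and> (\<forall>k. ce_set A (h k) = {x. R k x})"
proof -
  from ce_run[OF assms] obtain c where "\<And>z. R (pfst z) (psnd z) \<longleftrightarrow> run A c z \<noteq> None" by blast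
  then have "R k x \<longleftrightarrow> run A c (prod_encode (k, x)) \<noteq> None" for k x
    by (metis pfst_prod_encode psnd_prod_encode)
  moreover obtain h where "cfun {} h" "\<And>k x. part_fun A (h k) x = run A c (prod_encode (k, x))"
    using smn[of c] by blast
  ultimately show ?thesis unfolding ce_set_def by (intro exI[of _ h]) auto
qed

lemma cfun_smn:
  assumes "cfun A (\<lambda>z. g (pfst z) (psnd z))"
  shows "\<exists>h. cfun {} h \<and> (\<forall>k x. part_fun A (h k) x = Some (g k x))"
proof -
  from assms obtain c where "\<And>z. run A c z = Some (g (pfst z) (psnd z))" by (auto simp: cfun_def)
  moreover obtain h where "cfun {} h" "\<And>k x. part_fun A (h k) x = run A c (prod_encode (k, x))"
    using smn[of c] by blast
  ultimately show ?thesis by (intro exI[of _ h]) simp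
qed

text \<open>A computation relative to the jump asks finitely many questions. Correctness of the
  positive answers is c.e. in \<open>A\<close> and joins \<open>P\<close>; failure of a negative
  answer is the c.e. event \<open>N\<close>. The witnesses for \<open>P\<close> are finally absorbed
  into \<open>m\<close>. In \<open>P\<close> and \<open>N\<close>, \<open>w\<close> codes the code
  set, the set of triples and the output.\<close>

lemma ce_jump:
  assumes "ce (jump A) R"
  shows "\<exists>Q. ce A (\<lambda>z. Q (pfst z) (psnd z)) \<and> (\<forall>x. R x \<longleftrightarrow> (\<exists>m. \<not> Q x m))"
proof -
  from ce_run[OF assms] obtain c where "\<And>x. R x \<longleftrightarrow> run (jump A) c x \<noteq> None" by blast
  then have c: "R x \<longleftrightarrow> (\<exists>y. part_fun (jump A) (prog_encode c) x = Some y)" for x by simp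
  define P where "P = (\<lambda>x w. derivation (set_decode (pfst w)) (set_decode (pfst (psnd w))) \<and>
     triple_encode (prog_encode c) x (psnd (psnd w)) \<in> set_decode (pfst (psnd w)) \<and>
     (\<forall>x<pfst (psnd w). triple_encode (prod_encode (4, 0)) x 1 \<in> set_decode (pfst (psnd w)) \<longrightarrow> x \<in> ce_set A x))"
  define N where "N = (\<lambda>w. \<exists>x. x < pfst (psnd w) \<and>
     triple_encode (prod_encode (4, 0)) x 0 \<in> set_decode (pfst (psnd w)) \<and> x \<in> ce_set A x)"
  have R: "R x \<longleftrightarrow> (\<exists>w. P x w \<and> \<not> N w)" for x
  proof
    assume "R x"
    then obtain y C D where "derivation (set_decode C) (set_decode D)"
      "triple_encode (prog_encode c) x y \<in> set_decode D" "oracle_ok (jump A) (set_decode D)"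
      unfolding c part_fun_iff_derivation by blast
    then have "P x (triple_encode C D y) \<and> \<not> N (triple_encode C D y)"
      unfolding P_def N_def oracle_ok_set_decode jump_def by auto
    then show "\<exists>w. P x w \<and> \<not> N w" by blast
  next
    assume "\<exists>w. P x w \<and> \<not> N w"
    then show "R x"
      unfolding c part_fun_iff_derivation P_def N_def oracle_ok_set_decode jump_def by blast
  qed
  have "ce A (\<lambda>z. P (pfst z) (psnd z))" unfolding P_def
    by (intro ce_intros comp_intros ce_cpred[OF cpred_derivation])
  then show ?thesis
  proof (rule ceE)
    fix S assume S: "\<And>f g. cfun A f \<Longrightarrow> cfun A g \<Longrightarrow> cpred A (\<lambda>x. S (f x) (g x))"
      and P: "\<And>z. P (pfst z) (psnd z) \<longleftrightarrow> (\<exists>m. S z m)"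
    let ?Q = "\<lambda>x m. \<not> S (prod_encode (x, pfst m)) (psnd m) \<or> N (pfst m)"
    have "ce A (\<lambda>z. ?Q (pfst z) (psnd z))" unfolding N_def
      by (intro ce_or ce_cpred[OF cpred_not] S comp_intros)
         (intro ce_intros comp_intros)
    moreover have "R x \<longleftrightarrow> (\<exists>m. \<not> ?Q x m)" for x
      unfolding R using P[of "prod_encode (x, _)"]
      by (metis pfst_prod_encode psnd_prod_encode)
    ultimately show ?thesis by (intro exI[of _ ?Q]) simp
  qed
qed

section \<open>Rational-valued computable functions\<close>

text \<open>A difference of naturals over a positive natural represents every rational without
  signed codes, and comparisons become comparisons of naturals.\<close>

definition crat :: "nat set \<Rightarrow> (nat \<Rightarrow> real) \<Rightarrow> bool" where
  "crat A F \<longleftrightarrow> (\<exists>n p d. cfun A n \<and> cfun A p \<and> cfun A d \<and>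
     (\<forall>x. F x = (real (n x) - real (p x)) / real (Suc (d x))))"

lemma cratI:
  "cfun A n \<Longrightarrow> cfun A p \<Longrightarrow> cfun A d \<Longrightarrow>
   (\<And>x. F x = (real (n x) - real (p x)) / real (Suc (d x))) \<Longrightarrow> crat A F"
  unfolding crat_def by blast

lemma crat_of_nat [comp_intros]: "cfun A f \<Longrightarrow> crat A (\<lambda>x. real (f x))"
  by (rule cratI[of _ f "\<lambda>_. 0" "\<lambda>_. 0"]) (auto intro: comp_intros)

lemma crat_numeral [comp_intros]: "crat A (\<lambda>x. 0)" "crat A (\<lambda>x. 1)" "crat A (\<lambda>x. numeral w)"
  using crat_of_nat[OF cfun_const, of A 0] crat_of_nat[OF cfun_const, of A 1]
    crat_of_nat[OF cfun_const, of A "numeral w"] by simp_all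

lemma crat_add [comp_intros]:
  assumes "crat A F" "crat A G"
  shows "crat A (\<lambda>x. F x + G x)"
proof -
  from assms obtain n p d n' p' d' where
    F: "cfun A n" "cfun A p" "cfun A d" "\<And>x. F x = (real (n x) - real (p x)) / real (Suc (d x))" and
    G: "cfun A n'" "cfun A p'" "cfun A d'" "\<And>x. G x = (real (n' x) - real (p' x)) / real (Suc (d' x))"
    unfolding crat_def by metis
  show ?thesis
    \<comment> \<open>The last function is one less than the common denominator: (d + 1)(d' + 1) =
      (d d' + d + d') + 1.\<close>
    by (rule cratI[of _ "\<lambda>x. n x * Suc (d' x) + n' x * Suc (d x)"
          "\<lambda>x. p x * Suc (d' x) + p' x * Suc (d x)" "\<lambda>x. d x * d' x + d x + d' x"])
       (intro comp_intros F G | simp add: F(4) G(4) field_simps)+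
qed

lemma crat_uminus [comp_intros]:
  assumes "crat A F"
  shows "crat A (\<lambda>x. - F x)"
proof -
  from assms obtain n p d where
    F: "cfun A n" "cfun A p" "cfun A d" "\<And>x. F x = (real (n x) - real (p x)) / real (Suc (d x))"
    unfolding crat_def by metis
  show ?thesis by (rule cratI[OF F(2,1,3)]) (simp add: F(4) field_simps)
qed

lemma crat_diff [comp_intros]: "crat A F \<Longrightarrow> crat A G \<Longrightarrow> crat A (\<lambda>x. F x - G x)"
  using crat_add[OF _ crat_uminus, of A F G] by simp

lemma crat_mult [comp_intros]:
  assumes "crat A F" "crat A G"
  shows "crat A (\<lambda>x. F x * G x)"
proof -
  from assms obtain n p d n' p' d' where
    F: "cfun A n" "cfun A p" "cfun A d" "\<And>x. F x = (real (n x) - real (p x)) / real (Suc (d x))" and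
    G: "cfun A n'" "cfun A p'" "cfun A d'" "\<And>x. G x = (real (n' x) - real (p' x)) / real (Suc (d' x))"
    unfolding crat_def by metis
  show ?thesis
    by (rule cratI[of _ "\<lambda>x. n x * n' x + p x * p' x"
          "\<lambda>x. n x * p' x + p x * n' x" "\<lambda>x. d x * d' x + d x + d' x"])
       (intro comp_intros F G | simp add: F(4) G(4) field_simps)+
qed

lemma crat_if [comp_intros]:
  assumes "cpred A R" "crat A F" "crat A G"
  shows "crat A (\<lambda>x. if R x then F x else G x)"
proof -
  have "cfun A (\<lambda>x. of_bool (R x))" using assms(1) by (simp add: cpred_def)
  then have "crat A (\<lambda>x. real (of_bool (R x)) * F x + (1 - real (of_bool (R x))) * G x)"
    by (intro comp_intros assms)
  moreover have "real (of_bool (R x)) * F x + (1 - real (of_bool (R x))) * G x =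
      (if R x then F x else G x)" for x by simp
  ultimately show ?thesis by simp
qed

lemma crat_inverse_nat [comp_intros]:
  assumes "cfun A f"
  shows "crat A (\<lambda>x. 1 / real (f x))"
proof -
  have "crat A (\<lambda>x. 1 / real (Suc (f x - 1)))"
    by (rule cratI[of _ "\<lambda>_. 1" "\<lambda>_. 0" "\<lambda>x. f x - 1"]) (auto intro!: comp_intros assms)
  \<comment> \<open>Division by zero yields 0, hence the separate case.\<close>
  then have "crat A (\<lambda>x. if f x = 0 then 0 else 1 / real (Suc (f x - 1)))"
    by (intro comp_intros assms)
  moreover have "(if f x = 0 then 0 else 1 / real (Suc (f x - 1))) = 1 / real (f x)" for x by simp
  ultimately show ?thesis by simp
qed

lemma crat_half_power [comp_intros]:
  assumes "cfun A f"
  shows "crat A (\<lambda>x. (1/2) ^ f x)"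
  using crat_inverse_nat[of A "\<lambda>x. 2 ^ f x"] assms
  by (simp add: cfun_power cfun_const power_divide)

lemma cpred_crat_less [comp_intros]:
  assumes "crat A F" "crat A G"
  shows "cpred A (\<lambda>x. F x < G x)"
proof -
  obtain n p d where
    D: "cfun A n" "cfun A p" "\<And>x. F x - G x = (real (n x) - real (p x)) / real (Suc (d x))"
    using crat_diff[OF assms] unfolding crat_def by metis
  have "F x < G x \<longleftrightarrow> n x < p x" for x
  proof -
    have "F x < G x \<longleftrightarrow> F x - G x < 0" by simp
    also have "\<dots> \<longleftrightarrow> n x < p x" unfolding D(3) by (simp add: divide_less_0_iff)
    finally show ?thesis .
  qed
  then show ?thesis by (simp add: D cpred_less)
qed

lemma cpred_crat_le [comp_intros]: "crat A F \<Longrightarrow> crat A G \<Longrightarrow> cpred A (\<lambda>x. F x \<le> G x)"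
  unfolding not_less[symmetric] by (intro comp_intros)

lemmas [ce_intros] = cpred_crat_less[THEN ce_cpred] cpred_crat_le[THEN ce_cpred]

definition rat_of_code :: "nat \<Rightarrow> real" where
  "rat_of_code j = of_rat (nat_to_rat_surj j)"

definition pos_rat_of_code :: "nat \<Rightarrow> real" where
  "pos_rat_of_code j = of_rat (pos_rat j)"

lemma pos_rat_of_code: "pos_rat_of_code j = real (Suc (pfst j)) / real (Suc (psnd j))"
  by (simp add: pos_rat_of_code_def pos_rat_def prod_decode_eq_pair of_rat_divide)
     (simp add: of_rat_add)

lemma pos_rat_of_code_pos: "0 < pos_rat_of_code j"
  by (simp add: pos_rat_of_code)

lemma crat_pos_rat_of_code [comp_intros]:
  assumes "cfun A f"
  shows "crat A (\<lambda>x. pos_rat_of_code (f x))"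
  unfolding pos_rat_of_code
  by (rule cratI[of _ "\<lambda>x. Suc (pfst (f x))" "\<lambda>_. 0" "\<lambda>x. psnd (f x)"])
     (auto intro!: comp_intros assms)

lemma crat_rat_of_code [comp_intros]:
  assumes f: "cfun A f"
  shows "crat A (\<lambda>x. rat_of_code (f x))"
proof -
  define num :: "nat \<Rightarrow> real"
    where "num = (\<lambda>a. if even a then real (a div 2) else - real (a div 2) - 1)"
  \<comment> \<open>\<open>int_decode\<close> sends even codes to nonnegative and odd codes to
    negative integers. A denominator 0 can occur and gives the value 0 here as in
    \<open>nat_to_rat_surj\<close>.\<close>
  define inv :: "nat \<Rightarrow> real"
    where "inv = (\<lambda>b. if even b then 1 / real (b div 2) else - (1 / real (Suc (b div 2))))"
  have num: "real_of_int (int_decode a) = num a" for a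
    by (simp add: num_def int_decode_def sum_decode_def)
  have "real_of_int (- int k - 1) = - real (Suc k)" for k by simp
  then have "1 / real_of_int (- int k - 1) = - (1 / real (Suc k))" for k
    by (simp only: divide_minus_right)
  then have inv: "1 / real_of_int (int_decode b) = inv b" for b
    unfolding inv_def int_decode_def sum_decode_def by (cases "even b") simp_all
  have "rat_of_code j = num (pfst j) * inv (psnd j)" for j
  proof -
    have "rat_of_code j = real_of_int (int_decode (pfst j)) / real_of_int (int_decode (psnd j))"
      by (simp add: rat_of_code_def nat_to_rat_surj_def prod_decode_eq_pair of_rat_rat Fract_of_int_quotient of_rat_divide)
    then show ?thesis by (simp add: num[symmetric] inv[symmetric])
  qed
  then show ?thesis by (simp add: num_def inv_def) (intro comp_intros f)
qed

lemma rat_of_code_dense: "a < b \<Longrightarrow> \<exists>j. a < rat_of_code j \<and> rat_of_code j < b"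
  using Rats_dense_in_real[of a b] surj_of_rat_nat_to_rat_surj unfolding rat_of_code_def by metis

lemma pos_rat_of_code_surj:
  assumes "0 < q" "q \<in> \<rat>"
  shows "\<exists>j. pos_rat_of_code j = q"
proof -
  from assms obtain a b :: nat where ab: "b \<noteq> 0" "q = real a / real b"
    using Rats_abs_nat_div_natE[of q] by (metis abs_of_pos)
  with assms(1) have "a \<noteq> 0" by (intro notI) simp
  with ab show ?thesis
    by (intro exI[of _ "prod_encode (a - 1, b - 1)"]) (simp add: pos_rat_of_code)
qed

lemma pos_rat_of_code_dense:
  "0 \<le> a \<Longrightarrow> a < b \<Longrightarrow> \<exists>j. a < pos_rat_of_code j \<and> pos_rat_of_code j < b"
  using Rats_dense_in_real[of a b] pos_rat_of_code_surj by (metis order_le_less_trans)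

section \<open>Lower semicomputable functions\<close>

text \<open>The left cut is c.e. uniformly in the argument. A computable sequence of reals is
  handled as one with both \<open>F\<close> and \<open>- F\<close> in \<open>lsc\<close>, which
  keeps approximation errors out of the later arguments.\<close>

definition lsc :: "nat set \<Rightarrow> (nat \<Rightarrow> real) \<Rightarrow> bool" where
  "lsc A F \<longleftrightarrow> ce A (\<lambda>z. rat_of_code (pfst z) < F (psnd z))"

lemma lscI: "ce A (\<lambda>z. rat_of_code (pfst z) < F (psnd z)) \<Longrightarrow> lsc A F"
  by (simp add: lsc_def)

lemma lsc_mono: "lsc {} F \<Longrightarrow> lsc A F"
  unfolding lsc_def by (rule ce_mono)

lemma ce_rat_less_lsc [ce_intros]:
  assumes "lsc A F" "cfun A j" "cfun A f"
  shows "ce A (\<lambda>x. rat_of_code (j x) < F (f x))"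
  using assms unfolding lsc_def by (rule ce_subst2[of A "\<lambda>j x. rat_of_code j < F x"])

lemma lsc_subst:
  assumes "lsc A F" "cfun A f"
  shows "lsc A (\<lambda>x. F (f x))"
  by (rule lscI) (intro ce_rat_less_lsc assms(1) comp_intros assms(2)[THEN cfun_comp])

lemma crat_subst: "crat A G \<Longrightarrow> cfun A f \<Longrightarrow> crat A (\<lambda>x. G (f x))"
proof -
  assume "crat A G" and f: "cfun A f"
  then obtain n p d where
    F: "cfun A n" "cfun A p" "cfun A d" "\<And>x. G x = (real (n x) - real (p x)) / real (Suc (d x))"
    unfolding crat_def by metis
  show ?thesis unfolding F(4)
    by (rule cratI[of _ "\<lambda>x. n (f x)" "\<lambda>x. p (f x)" "\<lambda>x. d (f x)"])
       (intro F(1-3)[THEN cfun_comp] f refl)+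
qed

lemma ce_crat_less_lsc:
  assumes "crat A G" "lsc A F"
  shows "ce A (\<lambda>x. G x < F x)"
proof -
  have "G x < F x \<longleftrightarrow> (\<exists>j. G x < rat_of_code j \<and> rat_of_code j < F x)" for x
    using rat_of_code_dense by (meson order_less_trans)
  then show ?thesis
    by simp (intro ce_intros comp_intros crat_subst[OF assms(1)] assms(2))
qed

lemma lsc_crat:
  assumes "crat A G"
  shows "lsc A G"
  by (rule lscI) (intro ce_intros comp_intros crat_subst[OF assms])

lemma lsc_add:
  assumes "lsc A F" "lsc A G"
  shows "lsc A (\<lambda>x. F x + G x)"
proof -
  have eq: "q < F x + G x \<longleftrightarrow>
      (\<exists>i j. (rat_of_code i < F x \<and> rat_of_code j < G x) \<and> q \<le> rat_of_code i + rat_of_code j)" for q x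
  proof
    assume q: "q < F x + G x"
    obtain i where i: "F x - (F x + G x - q) / 2 < rat_of_code i" "rat_of_code i < F x"
      using rat_of_code_dense[of "F x - (F x + G x - q) / 2" "F x"] q by auto
    obtain j where j: "G x - (F x + G x - q) / 2 < rat_of_code j" "rat_of_code j < G x"
      using rat_of_code_dense[of "G x - (F x + G x - q) / 2" "G x"] q by auto
    from i(1) j(1) have "q \<le> rat_of_code i + rat_of_code j" by argo
    with i j show "\<exists>i j. (rat_of_code i < F x \<and> rat_of_code j < G x) \<and> q \<le> rat_of_code i + rat_of_code j"
      by blast
  qed force
  show ?thesis unfolding lsc_def eq by (intro ce_intros comp_intros assms)
qed

lemma lsc_mult_nat:
  assumes "cfun A n" "lsc A F"
  shows "lsc A (\<lambda>x. real (n x) * F x)"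
proof -
  have eq: "q < real k * F x \<longleftrightarrow> (\<exists>i. rat_of_code i < F x \<and> q < real k * rat_of_code i)" for q k x
  proof (cases "k = 0")
    case True
    then show ?thesis using rat_of_code_dense[of "F x - 1" "F x"] by auto
  next
    case False
    show ?thesis
    proof
      assume "q < real k * F x"
      with False have "q / real k < F x" by (simp add: field_simps)
      from rat_of_code_dense[OF this] show "\<exists>i. rat_of_code i < F x \<and> q < real k * rat_of_code i"
        using False by (auto simp: field_simps)
    next
      assume "\<exists>i. rat_of_code i < F x \<and> q < real k * rat_of_code i"
      then obtain i where "rat_of_code i < F x" "q < real k * rat_of_code i" by blast
      moreover have "real k * rat_of_code i \<le> real k * F x"
        using \<open>rat_of_code i < F x\<close> by (intro mult_left_mono) auto
      ultimately show "q < real k * F x" by linarith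
    qed
  qed
  show ?thesis unfolding lsc_def eq by (intro ce_intros comp_intros assms assms(1)[THEN cfun_comp])
qed

lemma half_power_less: "0 < (e::real) \<Longrightarrow> \<exists>m. (1/2) ^ m < e"
  using real_arch_pow_inv[of e "1/2"] by auto

lemma computes_real_lsc:
  assumes "cfun A g" "\<And>k. computes_real A (g k) (F k)"
  shows "lsc A F" "lsc A (\<lambda>k. - F k)"
proof -
  have c: "\<exists>j. part_fun A (g k) m = Some j \<and> \<bar>rat_of_code j - F k\<bar> \<le> (1/2) ^ m" for k m
    using assms(2)[of k] unfolding computes_real_def rat_of_code_def by blast
  have l: "q < F k \<longleftrightarrow> (\<exists>m j. part_fun A (g k) m = Some j \<and> q < rat_of_code j - (1/2) ^ m)" for q k
  proof
    assume "q < F k"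
    then obtain m where m: "(1/2) ^ m < (F k - q) / 2" using half_power_less[of "(F k - q) / 2"] by auto
    obtain j where "part_fun A (g k) m = Some j" "\<bar>rat_of_code j - F k\<bar> \<le> (1/2) ^ m" using c by blast
    moreover from this(2) m have "q < rat_of_code j - (1/2) ^ m" by (simp add: field_simps abs_le_iff)
    ultimately show "\<exists>m j. part_fun A (g k) m = Some j \<and> q < rat_of_code j - (1/2) ^ m" by blast
  next
    assume "\<exists>m j. part_fun A (g k) m = Some j \<and> q < rat_of_code j - (1/2) ^ m"
    then obtain m j where "part_fun A (g k) m = Some j" "q < rat_of_code j - (1/2) ^ m" by blast
    with c[of k m] show "q < F k" by (auto simp: abs_le_iff)
  qed
  have u: "q < - F k \<longleftrightarrow> (\<exists>m j. part_fun A (g k) m = Some j \<and> q < - rat_of_code j - (1/2) ^ m)" for q k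
  proof
    assume "q < - F k"
    then obtain m where m: "(1/2) ^ m < (- F k - q) / 2" using half_power_less[of "(- F k - q) / 2"] by auto
    obtain j where "part_fun A (g k) m = Some j" "\<bar>rat_of_code j - F k\<bar> \<le> (1/2) ^ m" using c by blast
    moreover from this(2) m have "q < - rat_of_code j - (1/2) ^ m" by (simp add: field_simps abs_le_iff)
    ultimately show "\<exists>m j. part_fun A (g k) m = Some j \<and> q < - rat_of_code j - (1/2) ^ m" by blast
  next
    assume "\<exists>m j. part_fun A (g k) m = Some j \<and> q < - rat_of_code j - (1/2) ^ m"
    then obtain m j where "part_fun A (g k) m = Some j" "q < - rat_of_code j - (1/2) ^ m" by blast
    with c[of k m] show "q < - F k" by (auto simp: abs_le_iff)
  qed
  show "lsc A F" unfolding lsc_def l by (intro ce_intros comp_intros assms(1)[THEN cfun_comp])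
  show "lsc A (\<lambda>k. - F k)" unfolding lsc_def u
    by (intro ce_intros comp_intros assms(1)[THEN cfun_comp])
qed

text \<open>The two inequalities searched for say that a rational is within 2^-m of the value. Both
  are c.e. and a solution always exists, so \<open>cfun_choice\<close> applies; s-m-n supplies the
  indices.\<close>

lemma lsc_uniformly_computes_real:
  assumes "lsc A F" "lsc A (\<lambda>k. - F k)"
  shows "uniformly (computes_real A) F"
proof -
  have "\<exists>j. rat_of_code j - (1/2) ^ m < F k \<and> - rat_of_code j - (1/2) ^ m < - F k" for k m
    using rat_of_code_dense[of "F k - (1/2) ^ m" "F k + (1/2) ^ m"] by (auto simp: field_simps)
  moreover have "ce A (\<lambda>z. rat_of_code (psnd z) - (1/2) ^ psnd (pfst z) < F (pfst (pfst z)) \<and>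
      - rat_of_code (psnd z) - (1/2) ^ psnd (pfst z) < - F (pfst (pfst z)))"
    by (intro ce_and ce_crat_less_lsc lsc_subst[OF assms(1)] lsc_subst[OF assms(2)] comp_intros)
  ultimately obtain g where g: "cfun A g"
    "\<And>z. rat_of_code (g z) - (1/2) ^ psnd z < F (pfst z) \<and> - rat_of_code (g z) - (1/2) ^ psnd z < - F (pfst z)"
    using cfun_choice[of A "\<lambda>z j. rat_of_code j - (1/2) ^ psnd z < F (pfst z) \<and>
      - rat_of_code j - (1/2) ^ psnd z < - F (pfst z)"] by auto
  have "cfun A (\<lambda>z. g (prod_encode (pfst z, psnd z)))" using g(1) by simp
  from cfun_smn[OF this] obtain h where
    h: "cfun {} h" "\<And>k m. part_fun A (h k) m = Some (g (prod_encode (k, m)))" by blast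
  have "computes_real A (h k) (F k)" for k
    unfolding computes_real_def rat_of_code_def[symmetric]
  proof
    fix m show "\<exists>j. part_fun A (h k) m = Some j \<and> \<bar>rat_of_code j - F k\<bar> \<le> (1/2) ^ m"
      using g(2)[of "prod_encode (k, m)"] h(2)[of k m] by (auto simp: abs_le_iff)
  qed
  with h(1) show ?thesis unfolding uniformly_def computable_fun_iff by blast
qed

lemma lower_semicomputes_real_lsc:
  assumes "uniformly lower_semicomputes_real F"
  shows "lsc A F"
proof -
  from assms obtain f where f: "cfun {} f" "\<And>k. lower_semicomputes_real (f k) (F k)"
    unfolding uniformly_def computable_fun_iff by blast
  have "rat_of_code j < F k \<longleftrightarrow> j \<in> ce_set {} (f k)" for j k
    using f(2)[of k] by (simp add: lower_semicomputes_real_def rat_of_code_def)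
  then have "lsc {} F" unfolding lsc_def
    by simp (intro ce_intros comp_intros f(1)[THEN cfun_comp])
  then show ?thesis by (rule lsc_mono)
qed

section \<open>Effectively open sets\<close>

lemma ideal_ball_eq: "ideal_ball s b = {x. dist x (s (pfst b)) < pos_rat_of_code (psnd b)}"
  by (simp add: ideal_ball_def prod_decode_eq_pair pos_rat_of_code_def)

lemma open_ideal_ball: "open (ideal_ball s b)"
proof -
  have "ideal_ball s b = ball (s (pfst b)) (pos_rat_of_code (psnd b))"
    by (auto simp: ideal_ball_eq dist_commute)
  then show ?thesis by simp
qed

lemma Sigma_set_1: "Sigma_set s A 1 e = (\<Union>i\<in>ce_set A e. ideal_ball s i)"
  by simp

text \<open>A uniformly Sigma_1(A) sequence, given by a c.e. relation between parameters and balls.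
  Substitution and set operations become logical operations on the relation;
  \<open>ceopen_index\<close> recovers an index function.\<close>

definition ceopen :: "(nat \<Rightarrow> 'a::polish_space) \<Rightarrow> nat set \<Rightarrow> (nat \<Rightarrow> 'a set) \<Rightarrow> bool" where
  "ceopen s A U \<longleftrightarrow> (\<exists>R. ce A (\<lambda>z. R (pfst z) (psnd z)) \<and>
     (\<forall>k y. y \<in> U k \<longleftrightarrow> (\<exists>b. R k b \<and> y \<in> ideal_ball s b)))"

named_theorems ceopen_intros

lemma ceopenI:
  "ce A (\<lambda>z. R (pfst z) (psnd z)) \<Longrightarrow>
   (\<And>k y. y \<in> U k \<longleftrightarrow> (\<exists>b. R k b \<and> y \<in> ideal_ball s b)) \<Longrightarrow> ceopen s A U"
  unfolding ceopen_def by blast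

lemma ceopenE:
  assumes "ceopen s A U"
  obtains R where "\<And>f g. cfun A f \<Longrightarrow> cfun A g \<Longrightarrow> ce A (\<lambda>x. R (f x) (g x))"
    "\<And>k y. y \<in> U k \<longleftrightarrow> (\<exists>b. R k b \<and> y \<in> ideal_ball s b)"
proof -
  from assms obtain R where R: "ce A (\<lambda>z. R (pfst z) (psnd z))"
    "\<And>k y. y \<in> U k \<longleftrightarrow> (\<exists>b. R k b \<and> y \<in> ideal_ball s b)" unfolding ceopen_def by blast
  show thesis by (rule that[OF ce_subst2[OF R(1)] R(2)])
qed

lemma ceopen_subst: "ceopen s A U \<Longrightarrow> cfun A f \<Longrightarrow> ceopen s A (\<lambda>k. U (f k))"
proof (erule ceopenE)
  fix R assume f: "cfun A f" and R: "\<And>f g. cfun A f \<Longrightarrow> cfun A g \<Longrightarrow> ce A (\<lambda>x. R (f x) (g x))"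
    and U: "\<And>k y. y \<in> U k \<longleftrightarrow> (\<exists>b. R k b \<and> y \<in> ideal_ball s b)"
  show ?thesis
    by (rule ceopenI[of _ "\<lambda>k. R (f k)"]) (intro R comp_intros f[THEN cfun_comp], rule U)
qed

lemma ceopen_open: "ceopen s A U \<Longrightarrow> open (U k)"
proof (erule ceopenE)
  fix R assume U: "\<And>k y. y \<in> U k \<longleftrightarrow> (\<exists>b. R k b \<and> y \<in> ideal_ball s b)"
  have "U k = (\<Union>b\<in>Collect (R k). ideal_ball s b)" using U by auto
  then show ?thesis by (simp add: open_UN open_ideal_ball)
qed

lemma ceopen_Sigma_set: "ceopen s A (\<lambda>e. Sigma_set s A 1 e)"
  by (rule ceopenI[of _ "\<lambda>e b. b \<in> ce_set A e"]) (intro ce_intros comp_intros, auto)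

lemma ceopen_index:
  assumes "ceopen s A U"
  shows "\<exists>h. cfun {} h \<and> (\<forall>k. U k = Sigma_set s A 1 (h k))"
proof -
  from assms obtain R where R: "ce A (\<lambda>z. R (pfst z) (psnd z))"
    "\<And>k y. y \<in> U k \<longleftrightarrow> (\<exists>b. R k b \<and> y \<in> ideal_ball s b)" unfolding ceopen_def by blast
  from ce_smn[OF R(1)] obtain h where h: "cfun {} h" "\<And>k. ce_set A (h k) = {x. R k x}" by blast
  have "U k = Sigma_set s A 1 (h k)" for k using R(2) by (auto simp: h(2))
  with h(1) show ?thesis by blast
qed

lemma ceopen_UN [ceopen_intros]:
  assumes "ceopen s A (\<lambda>z. U (pfst z) (psnd z))"
  shows "ceopen s A (\<lambda>k. \<Union>i. U k i)"
  using assms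
proof (rule ceopenE)
  fix R assume R: "\<And>f g. cfun A f \<Longrightarrow> cfun A g \<Longrightarrow> ce A (\<lambda>x. R (f x) (g x))"
    and U: "\<And>z y. y \<in> U (pfst z) (psnd z) \<longleftrightarrow> (\<exists>b. R z b \<and> y \<in> ideal_ball s b)"
  have U': "y \<in> U k i \<longleftrightarrow> (\<exists>b. R (prod_encode (k, i)) b \<and> y \<in> ideal_ball s b)" for y k i
    using U[of y "prod_encode (k, i)"] by simp
  show ?thesis
    by (rule ceopenI[of _ "\<lambda>k b. \<exists>i. R (prod_encode (k, i)) b"])
       (intro ce_intros R comp_intros, auto simp: U')
qed

lemma ceopen_UN_less [ceopen_intros]:
  assumes "ceopen s A (\<lambda>z. U (pfst z) (psnd z))" "cfun A n"
  shows "ceopen s A (\<lambda>k. \<Union>i\<in>{..<n k}. U k i)"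
  using assms(1)
proof (rule ceopenE)
  fix R assume R: "\<And>f g. cfun A f \<Longrightarrow> cfun A g \<Longrightarrow> ce A (\<lambda>x. R (f x) (g x))"
    and U: "\<And>z y. y \<in> U (pfst z) (psnd z) \<longleftrightarrow> (\<exists>b. R z b \<and> y \<in> ideal_ball s b)"
  have U': "y \<in> U k i \<longleftrightarrow> (\<exists>b. R (prod_encode (k, i)) b \<and> y \<in> ideal_ball s b)" for y k i
    using U[of y "prod_encode (k, i)"] by simp
  show ?thesis
    by (rule ceopenI[of _ "\<lambda>k b. \<exists>i. i < n k \<and> R (prod_encode (k, i)) b"])
       (intro ce_intros R comp_intros assms(2)[THEN cfun_comp], auto simp: U')
qed

lemma ceopen_if [ceopen_intros]:
  assumes "cpred A P" "ceopen s A U" "ceopen s A V"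
  shows "ceopen s A (\<lambda>k. if P k then U k else V k)"
  using assms(2,3)
proof (elim ceopenE)
  fix R S assume R: "\<And>f g. cfun A f \<Longrightarrow> cfun A g \<Longrightarrow> ce A (\<lambda>x. R (f x) (g x))"
    and S: "\<And>f g. cfun A f \<Longrightarrow> cfun A g \<Longrightarrow> ce A (\<lambda>x. S (f x) (g x))"
    and U: "\<And>k y. y \<in> U k \<longleftrightarrow> (\<exists>b. R k b \<and> y \<in> ideal_ball s b)"
    and V: "\<And>k y. y \<in> V k \<longleftrightarrow> (\<exists>b. S k b \<and> y \<in> ideal_ball s b)"
  show ?thesis
    by (rule ceopenI[of _ "\<lambda>k b. P k \<and> R k b \<or> \<not> P k \<and> S k b"])
       (intro ce_and ce_or R S ce_cpred comp_intros cpred_subst[OF assms(1)], auto simp: U V)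
qed

lemma ceopen_Un [ceopen_intros]:
  assumes "ceopen s A U" "ceopen s A V"
  shows "ceopen s A (\<lambda>k. U k \<union> V k)"
proof -
  have eq: "U k \<union> V k = (\<Union>i. if i = (0::nat) then U k else V k)" for k by (auto split: if_splits)
  show ?thesis unfolding eq
    by (intro ceopen_UN ceopen_if comp_intros ceopen_subst[OF assms(1)] ceopen_subst[OF assms(2)])
qed

section \<open>Balls and finite intersections in a computable metric space\<close>

locale computable_metric =
  fixes s :: "nat \<Rightarrow> 'a::polish_space"
  assumes cms: "computable_metric_space s"
begin

lemma ideal_ball_cover:
  assumes "0 < e"
  obtains b where "y \<in> ideal_ball s b" "pos_rat_of_code (psnd b) < e"
proof -
  obtain k where k: "0 < pos_rat_of_code k" "pos_rat_of_code k < e"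
    using pos_rat_of_code_dense[of 0 e] assms by auto
  have "y \<in> closure (range s)" using cms by (simp add: computable_metric_space_def)
  then obtain l where "dist (s l) y < pos_rat_of_code k"
    using k(1) unfolding closure_approachable by auto
  then show thesis using k
    by (intro that[of "prod_encode (l, k)"]) (auto simp: ideal_ball_eq dist_commute)
qed

lemma lsc_dist:
  assumes "cfun A i" "cfun A j"
  shows "lsc A (\<lambda>x. dist (s (i x)) (s (j x)))" "lsc A (\<lambda>x. - dist (s (i x)) (s (j x)))"
proof -
  from cms obtain f where f: "cfun {} f"
    "\<And>k. computes_real {} (f k) (dist (s (pfst k)) (s (psnd k)))"
    unfolding computable_metric_space_def uniformly_def computable_fun_iff
    by (auto simp: prod_decode_eq_pair)
  note l = computes_real_lsc[of "{}" f "\<lambda>k. dist (s (pfst k)) (s (psnd k))", OF f, THEN lsc_mono[of _ A]]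
  show "lsc A (\<lambda>x. dist (s (i x)) (s (j x)))" "lsc A (\<lambda>x. - dist (s (i x)) (s (j x)))"
    using lsc_subst[OF l(1) cfun_prod_encode[OF assms]] lsc_subst[OF l(2) cfun_prod_encode[OF assms]]
    by simp_all
qed

text \<open>Formal inclusion: a ball lies inside if its radius plus the distance of the centres is
  below \<open>r k\<close>. This is c.e. because distances are upper semicomputable, and each point
  of the large ball has a formally included ball around it.\<close>

lemma ceopen_ball [ceopen_intros]:
  assumes "crat A r" "cfun A i"
  shows "ceopen s A (\<lambda>k. {y. dist y (s (i k)) < r k})"
proof (rule ceopenI[of _ "\<lambda>k b. pos_rat_of_code (psnd b) - r k < - dist (s (pfst b)) (s (i k))"])
  show "ce A (\<lambda>z. pos_rat_of_code (psnd (psnd z)) - r (pfst z) < - dist (s (pfst (psnd z))) (s (i (pfst z))))"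
    by (intro ce_crat_less_lsc lsc_dist comp_intros crat_subst[OF assms(1)] assms(2)[THEN cfun_comp])
  fix k y
  show "y \<in> {y. dist y (s (i k)) < r k} \<longleftrightarrow>
    (\<exists>b. pos_rat_of_code (psnd b) - r k < - dist (s (pfst b)) (s (i k)) \<and> y \<in> ideal_ball s b)"
  proof
    assume "y \<in> {y. dist y (s (i k)) < r k}"
    \<comment> \<open>Half of the slack pays for the new radius, half for the distance from
      \<open>y\<close> to the new centre.\<close>
    then have "0 < (r k - dist y (s (i k))) / 2" by simp
    from ideal_ball_cover[OF this] obtain b where
      b: "y \<in> ideal_ball s b" "pos_rat_of_code (psnd b) < (r k - dist y (s (i k))) / 2" by blast
    have "dist (s (pfst b)) (s (i k)) \<le> dist y (s (pfst b)) + dist y (s (i k))"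
      by (metis dist_commute dist_triangle)
    with b have "pos_rat_of_code (psnd b) - r k < - dist (s (pfst b)) (s (i k))"
      by (simp add: ideal_ball_eq)
    with b(1) show "\<exists>b. pos_rat_of_code (psnd b) - r k < - dist (s (pfst b)) (s (i k)) \<and> y \<in> ideal_ball s b"
      by blast
  next
    assume "\<exists>b. pos_rat_of_code (psnd b) - r k < - dist (s (pfst b)) (s (i k)) \<and> y \<in> ideal_ball s b"
    then obtain b where "pos_rat_of_code (psnd b) - r k < - dist (s (pfst b)) (s (i k))"
      "dist y (s (pfst b)) < pos_rat_of_code (psnd b)" by (auto simp: ideal_ball_eq)
    moreover have "dist y (s (i k)) \<le> dist y (s (pfst b)) + dist (s (pfst b)) (s (i k))"
      by (rule dist_triangle)
    ultimately show "y \<in> {y. dist y (s (i k)) < r k}" by simp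
  qed
qed

lemma ceopen_outside_cball [ceopen_intros]:
  assumes "crat A r" "cfun A i"
  shows "ceopen s A (\<lambda>k. {y. r k < dist y (s (i k))})"
proof (rule ceopenI[of _ "\<lambda>k b. pos_rat_of_code (psnd b) + r k < dist (s (pfst b)) (s (i k))"])
  show "ce A (\<lambda>z. pos_rat_of_code (psnd (psnd z)) + r (pfst z) < dist (s (pfst (psnd z))) (s (i (pfst z))))"
    by (intro ce_crat_less_lsc lsc_dist comp_intros crat_subst[OF assms(1)] assms(2)[THEN cfun_comp])
  fix k y
  show "y \<in> {y. r k < dist y (s (i k))} \<longleftrightarrow>
    (\<exists>b. pos_rat_of_code (psnd b) + r k < dist (s (pfst b)) (s (i k)) \<and> y \<in> ideal_ball s b)"
  proof
    assume "y \<in> {y. r k < dist y (s (i k))}"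
    then have "0 < (dist y (s (i k)) - r k) / 2" by simp
    from ideal_ball_cover[OF this] obtain b where
      b: "y \<in> ideal_ball s b" "pos_rat_of_code (psnd b) < (dist y (s (i k)) - r k) / 2" by blast
    have "dist y (s (i k)) \<le> dist y (s (pfst b)) + dist (s (pfst b)) (s (i k))"
      by (rule dist_triangle)
    with b have "pos_rat_of_code (psnd b) + r k < dist (s (pfst b)) (s (i k))"
      by (simp add: ideal_ball_eq)
    with b(1) show "\<exists>b. pos_rat_of_code (psnd b) + r k < dist (s (pfst b)) (s (i k)) \<and> y \<in> ideal_ball s b"
      by blast
  next
    assume "\<exists>b. pos_rat_of_code (psnd b) + r k < dist (s (pfst b)) (s (i k)) \<and> y \<in> ideal_ball s b"
    then obtain b where "pos_rat_of_code (psnd b) + r k < dist (s (pfst b)) (s (i k))"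
      "dist y (s (pfst b)) < pos_rat_of_code (psnd b)" by (auto simp: ideal_ball_eq)
    moreover have "dist (s (pfst b)) (s (i k)) \<le> dist y (s (pfst b)) + dist y (s (i k))"
      by (metis dist_commute dist_triangle)
    ultimately show "y \<in> {y. r k < dist y (s (i k))}" by simp
  qed
qed

text \<open>A ball is listed if, for each \<open>i\<close>, it is formally included in some ball of
  \<open>U k i\<close>. The finite range of \<open>i\<close> keeps this c.e. and leaves room for a
  positive radius.\<close>

lemma ceopen_INT_less [ceopen_intros]:
  assumes "ceopen s A (\<lambda>z. U (pfst z) (psnd z))" "cfun A n"
  shows "ceopen s A (\<lambda>k. \<Inter>i\<in>{..<n k}. U k i)"
  using assms(1)
proof (rule ceopenE)
  fix R assume R: "\<And>f g. cfun A f \<Longrightarrow> cfun A g \<Longrightarrow> ce A (\<lambda>x. R (f x) (g x))"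
    and U: "\<And>z y. y \<in> U (pfst z) (psnd z) \<longleftrightarrow> (\<exists>b. R z b \<and> y \<in> ideal_ball s b)"
  have U': "y \<in> U k i \<longleftrightarrow> (\<exists>b. R (prod_encode (k, i)) b \<and> y \<in> ideal_ball s b)" for y k i
    using U[of y "prod_encode (k, i)"] by simp
  define S where "S = (\<lambda>k b. \<forall>i<n k. \<exists>c. R (prod_encode (k, i)) c \<and>
    pos_rat_of_code (psnd b) - pos_rat_of_code (psnd c) < - dist (s (pfst b)) (s (pfst c)))"
  show ?thesis
  proof (rule ceopenI[of _ S])
    show "ce A (\<lambda>z. S (pfst z) (psnd z))" unfolding S_def
      by (intro ce_ball ce_ex ce_and R ce_crat_less_lsc lsc_dist comp_intros assms(2)[THEN cfun_comp])
    fix k y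
    show "y \<in> (\<Inter>i\<in>{..<n k}. U k i) \<longleftrightarrow> (\<exists>b. S k b \<and> y \<in> ideal_ball s b)"
    proof
      assume "y \<in> (\<Inter>i\<in>{..<n k}. U k i)"
      then have "\<forall>i\<in>{..<n k}. \<exists>c. R (prod_encode (k, i)) c \<and> y \<in> ideal_ball s c"
        using U' by blast
      then obtain c where c: "\<And>i. i < n k \<Longrightarrow> R (prod_encode (k, i)) (c i) \<and> y \<in> ideal_ball s (c i)"
        by (metis lessThan_iff)
      \<comment> \<open>The element 1 keeps the minimum defined for an intersection over no
        index.\<close>
      define e where "e = Min (insert 1 ((\<lambda>i. (pos_rat_of_code (psnd (c i)) - dist y (s (pfst (c i)))) / 2) ` {..<n k}))"
      have "0 < e" unfolding e_def using c by (auto simp: ideal_ball_eq)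
      from ideal_ball_cover[OF this] obtain b where
        b: "y \<in> ideal_ball s b" "pos_rat_of_code (psnd b) < e" by blast
      have "S k b" unfolding S_def
      proof (intro allI impI)
        fix i assume i: "i < n k"
        have "e \<le> (pos_rat_of_code (psnd (c i)) - dist y (s (pfst (c i)))) / 2"
          unfolding e_def using i by (intro Min_le) auto
        moreover have "dist (s (pfst b)) (s (pfst (c i))) \<le> dist y (s (pfst b)) + dist y (s (pfst (c i)))"
          by (metis dist_commute dist_triangle)
        ultimately have "pos_rat_of_code (psnd b) - pos_rat_of_code (psnd (c i)) < - dist (s (pfst b)) (s (pfst (c i)))"
          using b by (simp add: ideal_ball_eq)
        with c[OF i] show "\<exists>c. R (prod_encode (k, i)) c \<and>
          pos_rat_of_code (psnd b) - pos_rat_of_code (psnd c) < - dist (s (pfst b)) (s (pfst c))" by blast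
      qed
      with b(1) show "\<exists>b. S k b \<and> y \<in> ideal_ball s b" by blast
    next
      assume "\<exists>b. S k b \<and> y \<in> ideal_ball s b"
      then obtain b where b: "S k b" "dist y (s (pfst b)) < pos_rat_of_code (psnd b)"
        by (auto simp: ideal_ball_eq)
      have "y \<in> U k i" if i: "i < n k" for i
      proof -
        from b(1) i obtain c where c: "R (prod_encode (k, i)) c"
          "pos_rat_of_code (psnd b) - pos_rat_of_code (psnd c) < - dist (s (pfst b)) (s (pfst c))"
          unfolding S_def by blast
        have "dist y (s (pfst c)) \<le> dist y (s (pfst b)) + dist (s (pfst b)) (s (pfst c))"
          by (rule dist_triangle)
        with b(2) c(2) have "y \<in> ideal_ball s c" by (simp add: ideal_ball_eq)
        with c(1) show ?thesis using U' by blast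
      qed
      then show "y \<in> (\<Inter>i\<in>{..<n k}. U k i)" by blast
    qed
  qed
qed

lemma ceopen_Int [ceopen_intros]:
  assumes "ceopen s A U" "ceopen s A V"
  shows "ceopen s A (\<lambda>k. U k \<inter> V k)"
proof -
  have eq: "U k \<inter> V k = (\<Inter>i\<in>{..<2}. if i = (0::nat) then U k else V k)" for k
    by (auto simp: less_2_cases_iff split: if_splits)
  show ?thesis unfolding eq
    by (intro ceopen_INT_less ceopen_if comp_intros ceopen_subst[OF assms(1)] ceopen_subst[OF assms(2)])
qed

section \<open>The jump and the effective Borel hierarchy\<close>

lemma ceopen_const:
  assumes "ce A P"
  shows "ceopen s A (\<lambda>k. {y. P k})"
proof (rule ceopenI[of _ "\<lambda>k b. P k"])
  show "ce A (\<lambda>z. P (pfst z))" by (intro ce_subst[OF assms] comp_intros)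
  show "y \<in> {y. P k} \<longleftrightarrow> (\<exists>b. P k \<and> y \<in> ideal_ball s b)" for k y
    using ideal_ball_cover[of 1 y] by auto
qed

text \<open>
  A set c.e. in \<open>jump A\<close> has a \<open>\<Sigma>\<^sub>2\<close> description \<open>\<exists>w. \<not> Q\<close> with \<open>Q\<close> c.e. in \<open>A\<close>; the summands whose
  witness \<open>w\<close> turns out to be wrong are erased by enlarging their complements to the whole space.
\<close>

lemma Sigma_set_jump:
  "\<exists>h. cfun {} h \<and> (\<forall>e. Sigma_set s (jump A) (Suc m) e = Sigma_set s A (Suc (Suc m)) (h e))"
proof -
  have "ce (jump A) (\<lambda>z. psnd z \<in> ce_set (jump A) (pfst z))" by (intro ce_intros comp_intros)
  from ce_jump[OF this] obtain Q where Q: "ce A (\<lambda>z. Q (pfst z) (psnd z))"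
    "\<And>z. psnd z \<in> ce_set (jump A) (pfst z) \<longleftrightarrow> (\<exists>w. \<not> Q z w)" by blast
  have jump: "i \<in> ce_set (jump A) e \<longleftrightarrow> (\<exists>w. \<not> Q (prod_encode (e, i)) w)" for e i
    using Q(2)[of "prod_encode (e, i)"] by simp
  note ceQ = ce_subst2[OF Q(1)]
  \<comment> \<open>Gathers a computably indexed family into one index, one level up, for the union
    of the complements.\<close>
  have outer: "\<exists>h. cfun {} h \<and> (\<forall>e. (\<Union>t. - Sigma_set s A (Suc l) (g (prod_encode (e, t)))) =
      Sigma_set s A (Suc (Suc l)) (h e))" if g: "cfun {} g" for g l
  proof -
    have "ce A (\<lambda>z. \<exists>t. psnd z = g (prod_encode (pfst z, t)))"
      by (intro ce_intros comp_intros cfun_mono[OF g, THEN cfun_comp])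
    from ce_smn[OF this] obtain h where "cfun {} h"
      "\<And>e. ce_set A (h e) = {x. \<exists>t. x = g (prod_encode (e, t))}" by blast
    then show ?thesis by (intro exI[of _ h]) auto
  qed
  show ?thesis
  proof (induction m)
    case 0
    \<comment> \<open>An open ball is the union of the closed balls with radius reduced by 1 / (j +
      1), whose complements are effectively open. \<open>t\<close> codes (e, i, w, j).\<close>
    define r where "r = (\<lambda>t. pos_rat_of_code (psnd (pfst (psnd t))) - 1 / real (Suc (psnd (psnd (psnd t)))))"
    define V where "V = (\<lambda>t. {y. r t < dist y (s (pfst (pfst (psnd t))))} \<union>
      {y. Q (prod_encode (pfst t, pfst (psnd t))) (pfst (psnd (psnd t)))})"
    have "ceopen s A V" unfolding V_def r_def
      by (intro ceopen_intros ceopen_const ceQ comp_intros)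
    from ceopen_index[OF this] obtain g where g: "cfun {} g" "\<And>t. V t = Sigma_set s A 1 (g t)" by blast
    from outer[OF g(1), of 0] obtain h where
      h: "cfun {} h" "\<And>e. (\<Union>t. - V (prod_encode (e, t))) = Sigma_set s A 2 (h e)"
      unfolding g(2) by (auto simp: numeral_2_eq_2)
    have "Sigma_set s (jump A) 1 e = (\<Union>t. - V (prod_encode (e, t)))" for e
    proof (intro set_eqI iffI)
      fix y assume "y \<in> Sigma_set s (jump A) 1 e"
      then obtain i w where i: "y \<in> ideal_ball s i" "\<not> Q (prod_encode (e, i)) w"
        using jump by auto
      then have "0 < pos_rat_of_code (psnd i) - dist y (s (pfst i))" by (simp add: ideal_ball_eq)
      then obtain j where "1 / real (Suc j) < pos_rat_of_code (psnd i) - dist y (s (pfst i))"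
        using nat_approx_posE by blast
      with i(2) have "y \<in> - V (prod_encode (e, prod_encode (i, prod_encode (w, j))))"
        by (simp add: V_def r_def)
      then show "y \<in> (\<Union>t. - V (prod_encode (e, t)))" by blast
    next
      fix y assume "y \<in> (\<Union>t. - V (prod_encode (e, t)))"
      then obtain t where t: "y \<notin> V (prod_encode (e, t))" by blast
      then have "pfst t \<in> ce_set (jump A) e" unfolding jump by (auto simp: V_def split: if_splits)
      moreover have "dist y (s (pfst (pfst t))) \<le> pos_rat_of_code (psnd (pfst t)) - 1 / real (Suc (psnd (psnd t)))"
        using t by (simp add: V_def r_def)
      then have "dist y (s (pfst (pfst t))) < pos_rat_of_code (psnd (pfst t))"
        by (rule order_le_less_trans) simp
      then have "y \<in> ideal_ball s (pfst t)" by (simp add: ideal_ball_eq)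
      ultimately show "y \<in> Sigma_set s (jump A) 1 e" by auto
    qed
    with h show ?case by (auto simp: numeral_2_eq_2)
  next
    case (Suc m)
    then obtain h where h: "cfun {} h"
      "\<And>e. Sigma_set s (jump A) (Suc m) e = Sigma_set s A (Suc (Suc m)) (h e)" by blast
    have "ce A (\<lambda>z. False)" by (rule ce_intros)
    \<comment> \<open>\<open>c\<close> indexes the empty set at level m + 1. Listing it in a set of
      level m + 2 adds the whole space; this is how a wrong witness erases its summand.\<close>
    then obtain c where c: "ce_set A c = {}"
      using ce_smn[of A "\<lambda>_ _. False"] by auto
    then have empty: "Sigma_set s A (Suc m) c = {}" by (cases m) auto
    have "ce A (\<lambda>z. psnd z \<in> ce_set A (h (pfst (psnd (pfst z)))) \<or>
        Q (prod_encode (pfst (pfst z), pfst (psnd (pfst z)))) (psnd (psnd (pfst z))) \<and> psnd z = c)"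
      by (intro ce_intros ceQ comp_intros cfun_mono[OF h(1), THEN cfun_comp])
    from ce_smn[OF this] obtain g where g: "cfun {} g"
      "\<And>t. ce_set A (g t) = {b. b \<in> ce_set A (h (pfst (psnd t))) \<or>
        Q (prod_encode (pfst t, pfst (psnd t))) (psnd (psnd t)) \<and> b = c}" by blast
    have Sg: "Sigma_set s A (Suc (Suc m)) (g t) = Sigma_set s A (Suc (Suc m)) (h (pfst (psnd t))) \<union>
      {y. Q (prod_encode (pfst t, pfst (psnd t))) (psnd (psnd t))}" for t
      by (auto simp: g(2) empty)
    from outer[OF g(1), of "Suc m"] obtain h' where h': "cfun {} h'"
      "\<And>e. (\<Union>t. - Sigma_set s A (Suc (Suc m)) (g (prod_encode (e, t)))) =
        Sigma_set s A (Suc (Suc (Suc m))) (h' e)" by blast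
    have "Sigma_set s (jump A) (Suc (Suc m)) e =
        (\<Union>t. - Sigma_set s A (Suc (Suc m)) (g (prod_encode (e, t))))" for e
    proof -
      have jump_set: "ce_set (jump A) e = {i. \<exists>w. \<not> Q (prod_encode (e, i)) w}"
        using jump by blast
      have "Sigma_set s (jump A) (Suc (Suc m)) e =
          (\<Union>i\<in>{i. \<exists>w. \<not> Q (prod_encode (e, i)) w}. - Sigma_set s A (Suc (Suc m)) (h i))"
        by (simp only: Sigma_set.simps(3)[of s "jump A" m e] jump_set h(2))
      also have "\<dots> = (\<Union>t. - Sigma_set s A (Suc (Suc m)) (g (prod_encode (e, t))))"
        unfolding Sg
      proof (intro set_eqI iffI)
        fix y assume "y \<in> (\<Union>i\<in>{i. \<exists>w. \<not> Q (prod_encode (e, i)) w}. - Sigma_set s A (Suc (Suc m)) (h i))"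
        then obtain i w where "\<not> Q (prod_encode (e, i)) w" "y \<notin> Sigma_set s A (Suc (Suc m)) (h i)"
          by blast
        then show "y \<in> (\<Union>t. - (Sigma_set s A (Suc (Suc m)) (h (pfst (psnd (prod_encode (e, t))))) \<union>
          {y. Q (prod_encode (pfst (prod_encode (e, t)), pfst (psnd (prod_encode (e, t)))))
                (psnd (psnd (prod_encode (e, t))))}))"
          by (intro UN_I[of "prod_encode (i, w)"]) (simp_all del: Sigma_set.simps)
      qed (auto simp del: Sigma_set.simps split: if_splits)
      finally show ?thesis .
    qed
    with h' show ?case by (intro exI[of _ h']) (simp del: Sigma_set.simps)
  qed
qed

text \<open>The induction peels off the innermost jump: the hypothesis is applied to
  \<open>jump A\<close>, hence \<open>A\<close> is arbitrary, and \<open>Sigma_set_jump\<close>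
  removes that last jump.\<close>

lemma Sigma_set_iter_jump:
  "\<exists>h. cfun {} h \<and> (\<forall>e. Sigma_set s (iter_jump m A) 1 e = Sigma_set s A (Suc m) (h e))"
proof (induction m arbitrary: A)
  case 0
  show ?case by (intro exI[of _ "\<lambda>x. x"]) (auto simp: iter_jump_def intro: comp_intros)
next
  case (Suc m)
  obtain h where h: "cfun {} h"
    "\<And>e. Sigma_set s (iter_jump m (jump A)) 1 e = Sigma_set s (jump A) (Suc m) (h e)"
    using Suc.IH by blast
  obtain g where g: "cfun {} g"
    "\<And>e. Sigma_set s (jump A) (Suc m) e = Sigma_set s A (Suc (Suc m)) (g e)"
    using Sigma_set_jump by blast
  have "iter_jump (Suc m) A = iter_jump m (jump A)"
    by (simp add: iter_jump_def funpow_swap1)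
  with h g show ?case by (intro exI[of _ "\<lambda>e. g (h e)"]) (auto intro: cfun_comp simp del: Sigma_set.simps)
qed

end

locale computable_space = computable_metric s + prob_space \<mu>
  for s :: "nat \<Rightarrow> 'a::polish_space" and \<mu> :: "'a measure" +
  assumes sets_eq: "sets \<mu> = sets borel"
    and measure_balls: "uniformly lower_semicomputes_real (\<lambda>u. measure \<mu> (\<Union>i\<in>set_decode u. ideal_ball s i))"
begin

lemma ceopen_sets: "ceopen s A U \<Longrightarrow> U k \<in> sets \<mu>"
  unfolding sets_eq by (intro borel_open ceopen_open)

text \<open>By continuity from below, the measure exceeds \<open>q\<close> as soon as a finite union
  of listed balls does. Such finite sets of balls can be enumerated, and
  \<open>measure_balls\<close> bounds their measures from below.\<close>

lemma lsc_measure: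
  assumes "ceopen s A U"
  shows "lsc A (\<lambda>k. measure \<mu> (U k))"
  using assms
proof (rule ceopenE)
  fix R assume R: "\<And>f g. cfun A f \<Longrightarrow> cfun A g \<Longrightarrow> ce A (\<lambda>x. R (f x) (g x))"
    and U: "\<And>k y. y \<in> U k \<longleftrightarrow> (\<exists>b. R k b \<and> y \<in> ideal_ball s b)"
  define m where "m = (\<lambda>u. measure \<mu> (\<Union>i\<in>set_decode u. ideal_ball s i))"
  have m: "lsc A m" unfolding m_def by (rule lower_semicomputes_real_lsc[OF measure_balls])
  have eq: "q < measure \<mu> (U k) \<longleftrightarrow> (\<exists>u. (\<forall>i<u. i \<in> set_decode u \<longrightarrow> R k i) \<and> q < m u)" for q k
  proof
    assume q: "q < measure \<mu> (U k)"
    define V where "V = (\<lambda>n. \<Union>i\<in>{i. i < n \<and> R k i}. ideal_ball s i)"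
    have "range V \<subseteq> sets \<mu>" by (auto simp: V_def sets_eq intro!: borel_open open_ideal_ball)
    moreover have "incseq V" unfolding V_def incseq_def by (intro allI impI UN_mono) auto
    ultimately have "(\<lambda>n. measure \<mu> (V n)) \<longlonglongrightarrow> measure \<mu> (\<Union>n. V n)"
      by (rule finite_Lim_measure_incseq)
    moreover have "(\<Union>n. V n) = U k" using U by (auto simp: V_def) (use lessI in blast)
    ultimately have "eventually (\<lambda>n. q < measure \<mu> (V n)) sequentially"
      using q by (auto simp: order_tendsto_iff)
    then obtain n where n: "q < measure \<mu> (V n)" by (auto simp: eventually_sequentially)
    let ?u = "set_encode {i. i < n \<and> R k i}"
    have "set_decode ?u = {i. i < n \<and> R k i}" by (rule set_encode_inverse) simp
    with n show "\<exists>u. (\<forall>i<u. i \<in> set_decode u \<longrightarrow> R k i) \<and> q < m u"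
      by (intro exI[of _ ?u]) (simp add: m_def V_def)
  next
    assume "\<exists>u. (\<forall>i<u. i \<in> set_decode u \<longrightarrow> R k i) \<and> q < m u"
    then obtain u where u: "\<And>i. i \<in> set_decode u \<Longrightarrow> R k i" "q < m u"
      using mem_set_decode_less by blast
    have "m u \<le> measure \<mu> (U k)" unfolding m_def
      using u(1) U by (intro finite_measure_mono ceopen_sets[OF assms]) auto
    with u(2) show "q < measure \<mu> (U k)" by linarith
  qed
  show ?thesis unfolding lsc_def eq
    by (intro ce_intros R m comp_intros)
qed

end

lemma cfun_subst2:
  "cfun A (\<lambda>z. f (pfst z) (psnd z)) \<Longrightarrow> cfun A g \<Longrightarrow> cfun A h \<Longrightarrow> cfun A (\<lambda>x. f (g x) (h x))"
  using cfun_comp[of A "\<lambda>z. f (pfst z) (psnd z)" "\<lambda>x. prod_encode (g x, h x)"]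
  by (simp add: cfun_prod_encode)

section \<open>Iterated preimages and level sets\<close>

lemma mem_partial_preimage_funpow:
  "y \<in> (partial_preimage T ^^ k) S \<longleftrightarrow> (\<exists>z\<in>S. partial_iterate T k y = Some z)"
proof (induction k arbitrary: S)
  case 0
  show ?case by (auto simp: partial_iterate_def)
next
  case (Suc k)
  have "y \<in> (partial_preimage T ^^ Suc k) S \<longleftrightarrow> y \<in> (partial_preimage T ^^ k) (partial_preimage T S)"
    by (simp add: funpow_swap1)
  also have "\<dots> \<longleftrightarrow> (\<exists>z\<in>S. partial_iterate T (Suc k) y = Some z)"
    unfolding Suc.IH by (auto simp: partial_iterate_def partial_preimage_def map_comp_Some_iff)
  finally show ?case .
qed

lemma partial_preimage_funpow_Int:
  "(partial_preimage T ^^ k) (S \<inter> S') = (partial_preimage T ^^ k) S \<inter> (partial_preimage T ^^ k) S'"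
  by (auto simp: mem_partial_preimage_funpow)

lemma partial_preimage_funpow_mono:
  "S \<subseteq> S' \<Longrightarrow> (partial_preimage T ^^ k) S \<subseteq> (partial_preimage T ^^ k) S'"
  unfolding subset_iff mem_partial_preimage_funpow by blast

lemma dom_subset_funpow_UNIV:
  assumes "ran T \<subseteq> dom T"
  shows "dom T \<subseteq> (partial_preimage T ^^ k) (dom T)"
proof (induction k)
  case (Suc k)
  have "dom T \<subseteq> partial_preimage T (dom T)"
    using assms by (auto simp: partial_preimage_def ran_def)
  also have "\<dots> \<subseteq> partial_preimage T ((partial_preimage T ^^ k) (dom T))"
    using partial_preimage_funpow_mono[of _ _ 1 T] Suc.IH by simp
  finally show ?case by simp
qed simp

text \<open>An axiomatic stand-in for f: \<open>L t\<close> and \<open>H t\<close> play {f < t} and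
  {f > t} at the positive rational coded by \<open>t\<close>, and \<open>- U\<close> plays {f \<le>
  0}. The later arguments use these inclusions only.\<close>

definition level_sets ::
  "(nat \<Rightarrow> 'a::polish_space) \<Rightarrow> nat set \<Rightarrow> 'a set \<Rightarrow> (nat \<Rightarrow> 'a set) \<Rightarrow> (nat \<Rightarrow> 'a set) \<Rightarrow> bool" where
  "level_sets s A U L H \<longleftrightarrow> ceopen s A L \<and> ceopen s A H \<and>
     (\<forall>t. L t \<inter> H t = {}) \<and>
     (\<forall>t t'. pos_rat_of_code t < pos_rat_of_code t' \<longrightarrow> L t' \<union> H t = UNIV) \<and>
     (\<forall>t. - U \<subseteq> L t) \<and> (\<forall>t. H t \<subseteq> U) \<and> U \<subseteq> (\<Union>t. H t)"

lemma level_sets_less: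
  assumes "level_sets s A U L H" "pos_rat_of_code t < pos_rat_of_code t'"
  shows "L t \<subseteq> L t'" "H t' \<subseteq> H t" "- H t \<subseteq> L t'"
  using assms unfolding level_sets_def by blast+

context computable_metric
begin

text \<open>A Sigma_1(A) set is a union of ideal balls; the oracle-free enumerations of their
  preimages are merged into one set c.e. in \<open>A\<close>. Computability of \<open>T\<close>
  speaks only about \<open>dom T\<close>, hence the intersection.\<close>

lemma computable_map_Sigma_set:
  assumes "computable_map s T"
  shows "\<exists>h. cfun {} h \<and> (\<forall>e. partial_preimage T (Sigma_set s A 1 e) = dom T \<inter> Sigma_set s A 1 (h e))"
proof -
  from assms obtain f where f: "cfun {} f"
    "\<And>i. partial_preimage T (ideal_ball s i) = dom T \<inter> Sigma_set s {} 1 (f i)"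
    unfolding computable_map_def uniformly_def computable_fun_iff by blast
  have "ce {} (\<lambda>z. psnd z \<in> ce_set {} (f (pfst z)))"
    by (intro ce_intros comp_intros f(1)[THEN cfun_comp])
  from ce_subst2[OF ce_mono[OF this]] have ce_f: "ce A (\<lambda>x. b x \<in> ce_set {} (f (i x)))"
    if "cfun A i" "cfun A b" for i b using that by blast
  have "ce A (\<lambda>z. \<exists>b. b \<in> ce_set A (pfst z) \<and> psnd z \<in> ce_set {} (f b))"
    by (intro ce_intros ce_f comp_intros)
  from ce_smn[OF this] obtain h where h: "cfun {} h"
    "\<And>e. ce_set A (h e) = {x. \<exists>b. b \<in> ce_set A e \<and> x \<in> ce_set {} (f b)}" by blast
  have "partial_preimage T (Sigma_set s A 1 e) = dom T \<inter> Sigma_set s A 1 (h e)" for e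
  proof -
    have "partial_preimage T (Sigma_set s A 1 e) = (\<Union>b\<in>ce_set A e. partial_preimage T (ideal_ball s b))"
      by (auto simp: partial_preimage_def)
    also have "\<dots> = dom T \<inter> Sigma_set s A 1 (h e)" unfolding f(2) by (auto simp: h(2))
    finally show ?thesis .
  qed
  with h(1) show ?thesis by blast
qed

text \<open>
  For a nonempty \<open>\<Sigma>\<^sub>1\<close> set \<open>U\<close> with enumeration \<open>B(c\<^sub>i, \<rho>\<^sub>i)\<close>, \<open>L t\<close> and \<open>H t\<close> are the sets where
  the function \<open>sup\<^sub>i min(1 / (i + 1), \<rho>\<^sub>i - d(-, c\<^sub>i))\<close> is below and above the threshold \<open>t\<close>.
\<close>

lemma Sigma_set_level_sets: "\<exists>L H. level_sets s A (Sigma_set s A 1 e) L H"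
proof (cases "ce_set A e = {}")
  case True
  then have "Sigma_set s A 1 e = {}" by simp
  then show ?thesis
    using ceopen_const[of A "\<lambda>_. True"] ceopen_const[of A "\<lambda>_. False"]
    by (intro exI[of _ "\<lambda>_. UNIV"] exI[of _ "\<lambda>_. {}"]) (auto simp: level_sets_def intro: ce_intros)
next
  case False
  define U where "U = Sigma_set s A 1 e"
  from False obtain x0 where x0: "x0 \<in> ce_set A e" by blast
  have "ce A (\<lambda>x. x \<in> ce_set A e)" by (intro ce_intros comp_intros)
  from ce_enumeration[of A "\<lambda>x. x \<in> ce_set A e", OF this x0] obtain w where
    w: "cfun A w" "\<And>x. x \<in> ce_set A e \<longleftrightarrow> x \<in> range w" by blast
  define c where "c = (\<lambda>i. pfst (w i))"
  define \<rho> where "\<rho> = (\<lambda>i. pos_rat_of_code (psnd (w i)))"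
  let ?r = pos_rat_of_code
  have U: "y \<in> U \<longleftrightarrow> (\<exists>i. dist y (s (c i)) < \<rho> i)" for y
    unfolding U_def Sigma_set_1 by (auto simp: w(2) c_def \<rho>_def ideal_ball_eq)
  \<comment> \<open>The cap 1 / (i + 1) leaves finitely many relevant \<open>i\<close>, so
    \<open>L t\<close> is a finite intersection; the radius -1 makes the condition void for the
    others. In \<open>H\<close>, the radius 0 contributes an empty ball.\<close>
  define L where "L = (\<lambda>t. \<Inter>i\<in>{..<Suc (psnd t)}.
    {y. (if real (Suc i) * ?r t \<le> 1 then \<rho> i - ?r t else -1) < dist y (s (c i))})"
  define H where "H = (\<lambda>t. \<Union>i.
    {y. dist y (s (c i)) < (if real (Suc i) * ?r t < 1 then \<rho> i - ?r t else 0)})"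
  have "ceopen s A L" unfolding L_def c_def \<rho>_def
    by (intro ceopen_intros comp_intros w(1)[THEN cfun_comp])
  moreover have "ceopen s A H" unfolding H_def c_def \<rho>_def
    by (intro ceopen_intros comp_intros w(1)[THEN cfun_comp])
  \<comment> \<open>For t = (p + 1) / (q + 1) the inequality gives i + 1 \<le> q + 1, where q is
    \<open>psnd t\<close>.\<close>
  moreover have bound: "i < Suc (psnd t)" if "real (Suc i) * ?r t \<le> 1" for i t
  proof -
    have "real (Suc i) * real (Suc (pfst t)) \<le> real (Suc (psnd t))"
      using that by (simp add: pos_rat_of_code field_simps)
    then have "Suc i * Suc (pfst t) \<le> Suc (psnd t)" by (simp only: of_nat_mult[symmetric] of_nat_le_iff)
    then show ?thesis by simp
  qed
  have minus: "- 1 < dist y z" for y z :: 'a using zero_le_dist[of y z] by linarith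
  have L: "y \<in> L t \<longleftrightarrow> (\<forall>i. real (Suc i) * ?r t \<le> 1 \<longrightarrow> \<rho> i - ?r t < dist y (s (c i)))" for y t
    unfolding L_def using bound[of _ t] minus by (auto split: if_splits)
  have H: "y \<in> H t \<longleftrightarrow> (\<exists>i. real (Suc i) * ?r t < 1 \<and> dist y (s (c i)) < \<rho> i - ?r t)" for y t
    unfolding H_def by (auto split: if_splits)
  have disj: "L t \<inter> H t = {}" for t
  proof -
    have "y \<notin> L t" if "y \<in> H t" for y
    proof -
      from that obtain i where "real (Suc i) * ?r t < 1" "dist y (s (c i)) < \<rho> i - ?r t"
        unfolding H by blast
      then show ?thesis unfolding L by (intro notI) (use order_less_asym less_imp_le in blast)
    qed
    then show ?thesis by blast
  qed
  have cover: "L t' \<union> H t = UNIV" if tt: "?r t < ?r t'" for t t'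
  proof -
    have "y \<in> H t" if y: "y \<notin> L t'" for y
    proof -
      from y obtain i where i: "real (Suc i) * ?r t' \<le> 1" "dist y (s (c i)) \<le> \<rho> i - ?r t'"
        unfolding L by (auto simp: not_less)
      have "real (Suc i) * ?r t < real (Suc i) * ?r t'" using tt by (intro mult_strict_left_mono) auto
      with i(1) have "real (Suc i) * ?r t < 1" by linarith
      moreover have "dist y (s (c i)) < \<rho> i - ?r t" using i(2) tt by linarith
      ultimately show ?thesis unfolding H by blast
    qed
    then show ?thesis by blast
  qed
  have sub: "- U \<subseteq> L t" for t
  proof
    fix y assume "y \<in> - U"
    then have "\<rho> i \<le> dist y (s (c i))" for i using U by (auto simp: not_less)
    then have "\<rho> i - ?r t < dist y (s (c i))" for i
      using pos_rat_of_code_pos[of t] by (smt (verit))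
    then show "y \<in> L t" using L by blast
  qed
  have HU: "H t \<subseteq> U" for t
  proof
    fix y assume "y \<in> H t"
    then obtain i where "dist y (s (c i)) < \<rho> i - ?r t" using H by blast
    then have "dist y (s (c i)) < \<rho> i" using pos_rat_of_code_pos[of t] by linarith
    then show "y \<in> U" using U by blast
  qed
  have UH: "U \<subseteq> (\<Union>t. H t)"
  proof
    fix y assume "y \<in> U"
    then obtain i where i: "dist y (s (c i)) < \<rho> i" using U by blast
    obtain t where "?r t < min (1 / real (Suc i)) (\<rho> i - dist y (s (c i)))"
      using pos_rat_of_code_dense[of 0 "min (1 / real (Suc i)) (\<rho> i - dist y (s (c i)))"] i by auto
    then have "real (Suc i) * ?r t < 1" "dist y (s (c i)) < \<rho> i - ?r t"
      by (auto simp: field_simps)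
    then show "y \<in> (\<Union>t. H t)" using H by blast
  qed
  ultimately show ?thesis using disj cover sub HU UH unfolding level_sets_def U_def by blast
qed

end

section \<open>Measures of level sets and the choice of thresholds\<close>

context computable_space
begin

lemma space_eq: "space \<mu> = UNIV"
  using sets_eq_imp_space_eq[OF sets_eq] by simp

lemma Compl_sets: "X \<in> sets \<mu> \<Longrightarrow> - X \<in> sets \<mu>"
  using sets.compl_sets[of X \<mu>] by (simp add: space_eq Compl_eq_Diff_UNIV)

lemma measure_Compl: "X \<in> sets \<mu> \<Longrightarrow> measure \<mu> (- X) = 1 - measure \<mu> X"
  using prob_compl[of X] by (simp add: space_eq Compl_eq_Diff_UNIV)

lemma level_sets_sets:
  assumes "level_sets s A U L H"
  shows "L t \<in> sets \<mu>" "H t \<in> sets \<mu>" "U \<in> sets \<mu>"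
proof -
  have *: "ceopen s A L" "ceopen s A H" "U = (\<Union>t. H t)"
    using assms unfolding level_sets_def by blast+
  show "L t \<in> sets \<mu>" using *(1) by (rule ceopen_sets)
  show "H t \<in> sets \<mu>" using *(2) by (rule ceopen_sets)
  show "U \<in> sets \<mu>" unfolding *(3) using ceopen_sets[OF *(2)] by auto
qed

lemma measure_level_set_approx:
  assumes LH: "level_sets s A U L H" and "0 < e"
  shows "\<exists>t. measure \<mu> U - e < measure \<mu> (H t)"
proof -
  \<comment> \<open>Codes of the thresholds 1 / (n + 1), which tend to 0, so that
    \<open>H (c n)\<close> increases to \<open>U\<close>.\<close>
  define c where "c = (\<lambda>n. prod_encode (0, n))"
  have c: "pos_rat_of_code (c n) = 1 / real (Suc n)" for n
    by (simp add: c_def pos_rat_of_code)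
  have "incseq (\<lambda>n. H (c n))"
    by (intro incseq_SucI level_sets_less(2)[OF LH]) (simp add: c field_simps)
  moreover have "(\<Union>n. H (c n)) = U"
  proof -
    have "y \<in> (\<Union>n. H (c n))" if "y \<in> U" for y
    proof -
      from that LH obtain t where t: "y \<in> H t" unfolding level_sets_def by blast
      obtain n where "pos_rat_of_code (c n) < pos_rat_of_code t"
        using nat_approx_posE[OF pos_rat_of_code_pos] unfolding c by blast
      from level_sets_less(2)[OF LH this] t show ?thesis by blast
    qed
    then show ?thesis using LH unfolding level_sets_def by blast
  qed
  ultimately have "(\<lambda>n. measure \<mu> (H (c n))) \<longlonglongrightarrow> measure \<mu> U"
    using finite_Lim_measure_incseq[of "\<lambda>n. H (c n)"] level_sets_sets[OF LH] by auto
  then have "eventually (\<lambda>n. measure \<mu> U - e < measure \<mu> (H (c n))) sequentially"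
    using \<open>0 < e\<close> by (auto simp: order_tendsto_iff)
  then show ?thesis by (auto simp: eventually_sequentially)
qed

text \<open>
  Pigeonhole: the level sets between consecutive thresholds are disjoint, so one of them is small.
\<close>

lemma measure_level_set_gap:
  assumes LH: "level_sets s A U L H" and "0 < e"
    and ab: "pos_rat_of_code a < pos_rat_of_code b"
  shows "\<exists>a' b'. pos_rat_of_code a < pos_rat_of_code a' \<and> pos_rat_of_code a' < pos_rat_of_code b' \<and>
    pos_rat_of_code b' < pos_rat_of_code b \<and> 1 - e < measure \<mu> (L a' \<union> H b')"
proof -
  let ?r = pos_rat_of_code
  note sets = level_sets_sets[OF LH]
  obtain N where N: "1 / real (Suc N) < e" using nat_approx_posE[OF \<open>0 < e\<close>] by blast
  \<comment> \<open>Equally spaced thresholds. Those with index 0 to N + 1 lie strictly inside the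
    interval and bound N + 1 slices, where (N + 1) e > 1.\<close>
  define p where "p = (\<lambda>i. ?r a + (?r b - ?r a) * (real (Suc i) / real (N + 3)))"
  have "?r t \<in> \<rat>" for t unfolding pos_rat_of_code_def by simp
  then have "p i \<in> \<rat>" for i unfolding p_def by (intro Rats_add Rats_mult Rats_diff Rats_divide) auto
  moreover have p_gt: "?r a < p i" for i unfolding p_def using ab by simp
  then have "0 < p i" for i using pos_rat_of_code_pos[of a] less_trans by blast
  ultimately have "\<exists>t. ?r t = p i" for i using pos_rat_of_code_surj by blast
  then obtain c where c: "\<And>i. ?r (c i) = p i" by metis
  have p_less: "p i < p (Suc i)" for i
    unfolding p_def using ab by (intro add_strict_left_mono mult_strict_left_mono divide_strict_right_mono) auto
  have p_lt: "p i < ?r b" if "i \<le> Suc N" for i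
  proof -
    have "(?r b - ?r a) * (real (Suc i) / real (N + 3)) < (?r b - ?r a) * 1"
      using ab that by (intro mult_strict_left_mono) auto
    then show ?thesis by (simp add: p_def)
  qed
  have "\<exists>i<Suc N. measure \<mu> (L (c (Suc i))) - measure \<mu> (L (c i)) < e"
  proof (rule ccontr)
    assume "\<not> ?thesis"
    then have "(\<Sum>i<Suc N. e) \<le> (\<Sum>i<Suc N. measure \<mu> (L (c (Suc i))) - measure \<mu> (L (c i)))"
      by (intro sum_mono) (meson lessThan_iff not_less)
    also have "\<dots> = measure \<mu> (L (c (Suc N))) - measure \<mu> (L (c 0))"
      by (rule sum_lessThan_telescope)
    also have "\<dots> \<le> 1" using prob_le_1[of "L (c (Suc N))"] measure_nonneg[of \<mu> "L (c 0)"] by linarith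
    finally show False using N by (simp add: field_simps)
  qed
  then obtain i where i: "i < Suc N" "measure \<mu> (L (c (Suc i))) - measure \<mu> (L (c i)) < e" by blast
  \<comment> \<open>What \<open>L (c i)\<close> and \<open>H b'\<close> both miss has f between the
    two thresholds, and lies in the small slice because \<open>b'\<close> stays below the next
    threshold.\<close>
  obtain b' where b': "?r (c i) < ?r b'" "?r b' < ?r (c (Suc i))"
    using pos_rat_of_code_dense[of "?r (c i)" "?r (c (Suc i))"] p_less[of i] pos_rat_of_code_pos[of "c i"]
    unfolding c by auto
  have "measure \<mu> (- (L (c i) \<union> H b')) \<le> measure \<mu> (L (c (Suc i)) - L (c i))"
    using level_sets_less(3)[OF LH b'(2)] sets by (intro finite_measure_mono) auto
  also have "\<dots> = measure \<mu> (L (c (Suc i))) - measure \<mu> (L (c i))"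
    using level_sets_less(1)[OF LH, of "c i" "c (Suc i)"] p_less[of i] sets
    by (intro finite_measure_Diff) (auto simp: c)
  finally have "1 - e < measure \<mu> (L (c i) \<union> H b')"
    using i(2) measure_Compl[of "L (c i) \<union> H b'"] sets by simp
  moreover have "?r b' < ?r b" using b'(2) p_lt[of "Suc i"] i(1) by (simp add: c)
  moreover have "?r a < ?r (c i)" using p_gt by (simp add: c)
  ultimately show ?thesis using b'(1) by blast
qed

text \<open>The conditions bound measures of open sets from below, hence are c.e. and can be met by
  search. The measure of \<open>U\<close> enters through the start value. The level sets between the
  thresholds become small in measure; the thresholds themselves need not approach each
  other.\<close>

lemma nested_thresholds:
  assumes LH: "level_sets s A U L H" and U: "lsc A (\<lambda>_. - measure \<mu> U)"
  shows "\<exists>a b. cfun A (\<lambda>z. a (pfst z) (psnd z)) \<and> cfun A (\<lambda>z. b (pfst z) (psnd z)) \<and>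
    (\<forall>k m. pos_rat_of_code (a k m) < pos_rat_of_code (b k m) \<and>
       pos_rat_of_code (a k m) < pos_rat_of_code (a k (Suc m)) \<and>
       pos_rat_of_code (b k (Suc m)) < pos_rat_of_code (b k m) \<and>
       1 - (1/2) ^ m < measure \<mu> (L (a k (Suc m)) \<union> H (b k (Suc m)))) \<and>
    (\<forall>k. measure \<mu> U - (1/2) ^ Suc k < measure \<mu> (H (b k 0)))"
proof -
  let ?r = pos_rat_of_code
  have open_LH: "ceopen s A L" "ceopen s A H" using LH unfolding level_sets_def by blast+
  define R0 where "R0 = (\<lambda>k q. ?r (pfst q) < ?r (psnd q) \<and>
    - ((1/2) ^ Suc k) < measure \<mu> (H (psnd q)) + - measure \<mu> U)"
  have "ce A (\<lambda>z. R0 (pfst z) (psnd z))" unfolding R0_def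
    by (intro ce_and ce_crat_less_lsc lsc_add U lsc_measure ceopen_subst[OF open_LH(2)]
        ce_intros comp_intros)
  moreover have "\<exists>q. R0 k q" for k
  proof -
    obtain b where b: "measure \<mu> U - (1/2) ^ Suc k < measure \<mu> (H b)"
      using measure_level_set_approx[OF LH, of "(1/2) ^ Suc k"] by auto
    obtain a where "?r a < ?r b"
      using pos_rat_of_code_dense[of 0 "?r b"] pos_rat_of_code_pos[of b] by auto
    with b have "R0 k (prod_encode (a, b))" by (simp add: R0_def)
    then show ?thesis by blast
  qed
  ultimately obtain f0 where f0: "cfun A f0" "\<And>k. R0 k (f0 k)"
    using cfun_choice[of A R0] by blast
  \<comment> \<open>The guarding implication ensures a solution for every \<open>x\<close>, so that
    the choice is total; \<open>ab\<close> shows below that the guard always holds along the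
    recursion.\<close>
  define R where "R = (\<lambda>x q. ?r (pfst (psnd x)) < ?r (psnd (psnd x)) \<longrightarrow>
    ((?r (pfst (psnd x)) < ?r (pfst q) \<and> ?r (pfst q) < ?r (psnd q)) \<and> ?r (psnd q) < ?r (psnd (psnd x))) \<and>
      1 - (1/2) ^ pfst x < measure \<mu> (L (pfst q) \<union> H (psnd q)))"
  have "ce A (\<lambda>z. R (pfst z) (psnd z))" unfolding R_def
    by (intro ce_imp ce_and ce_crat_less_lsc[of A _ "\<lambda>x. measure \<mu> (U' x)" for U'] lsc_measure
        ceopen_Un ceopen_subst[OF open_LH(1)] ceopen_subst[OF open_LH(2)] ce_intros comp_intros)
  moreover have "\<exists>q. R x q" for x
  proof (cases "?r (pfst (psnd x)) < ?r (psnd (psnd x))")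
    case True
    from measure_level_set_gap[OF LH _ True, of "(1/2) ^ pfst x"] obtain a b where
      "R x (prod_encode (a, b))" unfolding R_def by auto
    then show ?thesis by blast
  qed (simp add: R_def)
  ultimately obtain f where f: "cfun A f" "\<And>x. R x (f x)"
    using cfun_choice[of A R] by blast
  define q where "q = (\<lambda>k m. rec_nat (f0 k) (\<lambda>m p. f (prod_encode (m, p))) m)"
  have "cfun A (\<lambda>z. q (pfst z) (psnd z))" unfolding q_def
    by (intro comp_intros f0(1)[THEN cfun_comp] f(1)[THEN cfun_comp])
  moreover have ab: "?r (pfst (q k m)) < ?r (psnd (q k m))" for k m
  proof (induction m)
    case 0
    show ?case using f0(2)[of k] by (simp add: q_def R0_def)
  next
    case (Suc m)
    then show ?case using f(2)[of "prod_encode (m, q k m)"] by (simp add: q_def R_def)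
  qed
  moreover have "measure \<mu> U - (1/2) ^ Suc k < measure \<mu> (H (psnd (q k 0)))" for k
    using f0(2)[of k] by (simp add: q_def R0_def)
  moreover have "?r (pfst (q k m)) < ?r (pfst (q k (Suc m)))" "?r (psnd (q k (Suc m))) < ?r (psnd (q k m))"
    "1 - (1/2) ^ m < measure \<mu> (L (pfst (q k (Suc m))) \<union> H (psnd (q k (Suc m))))" for k m
    using f(2)[of "prod_encode (m, q k m)"] ab[of k m] by (simp_all add: q_def R_def)
  ultimately show ?thesis
    by (intro exI[of _ "\<lambda>k m. pfst (q k m)"] exI[of _ "\<lambda>k m. psnd (q k m)"]) (auto intro: comp_intros)
qed

end

section \<open>Recurrence\<close>

locale computable_system = computable_space s \<mu>
  for s :: "nat \<Rightarrow> 'a::polish_space" and \<mu> :: "'a measure" +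
  fixes T :: "'a \<rightharpoonup> 'a"
  assumes preserving: "measure_preserving_map \<mu> T" and computable: "computable_map s T"
begin

lemma dom_sets: "dom T \<in> sets \<mu>" and measure_dom: "measure \<mu> (dom T) = 1"
proof -
  have "dom T = partial_preimage T UNIV" by (auto simp: partial_preimage_def)
  with preserving show "dom T \<in> sets \<mu>" "measure \<mu> (dom T) = 1"
    unfolding measure_preserving_map_def sets_eq
    by (metis space_borel sets.top, metis prob_space space_eq space_borel sets.top)
qed

lemma measure_Int_dom:
  assumes "X \<in> sets \<mu>"
  shows "measure \<mu> (X \<inter> dom T) = measure \<mu> X"
proof -
  have "measure \<mu> (X - dom T) \<le> measure \<mu> (space \<mu> - dom T)"
    using sets.compl_sets[OF dom_sets] by (intro finite_measure_mono) (auto simp: space_eq)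
  also have "\<dots> = 0" using prob_compl[OF dom_sets] measure_dom by simp
  finally show ?thesis using finite_measure_Diff'[OF assms dom_sets] measure_nonneg[of \<mu> "X - dom T"] by simp
qed

lemma funpow_sets: "X \<in> sets \<mu> \<Longrightarrow> (partial_preimage T ^^ i) X \<in> sets \<mu>"
  using preserving unfolding measure_preserving_map_def sets_eq by (induction i) auto

lemma measure_funpow: "X \<in> sets \<mu> \<Longrightarrow> measure \<mu> ((partial_preimage T ^^ i) X) = measure \<mu> X"
  using preserving funpow_sets unfolding measure_preserving_map_def sets_eq
  by (induction i) auto

lemma dom_subset_funpow: "dom T \<subseteq> (partial_preimage T ^^ k) (dom T)"
  using preserving by (intro dom_subset_funpow_UNIV) (simp add: measure_preserving_map_def)

text \<open>For i < l, \<open>D\<close> lies in the preimage of \<open>U\<close> of order l - i, so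
  the i-th preimage of \<open>D\<close> lies in the l-th preimage of \<open>U\<close>, which is
  disjoint from the l-th preimage of \<open>D\<close>.\<close>

lemma no_return_measure:
  assumes D: "D \<in> sets \<mu>" "D \<subseteq> - U" "\<And>i. 1 \<le> i \<Longrightarrow> i \<le> j \<Longrightarrow> D \<subseteq> (partial_preimage T ^^ i) U"
  shows "measure \<mu> D \<le> 1 / real (Suc j)"
proof -
  let ?D = "\<lambda>i. (partial_preimage T ^^ i) D"
  have disj: "?D i \<inter> ?D l = {}" if "i < l" "l \<le> j" for i l
  proof -
    have "?D i \<subseteq> (partial_preimage T ^^ i) ((partial_preimage T ^^ (l - i)) U)"
      using that by (intro partial_preimage_funpow_mono D(3)) auto
    also have "\<dots> = (partial_preimage T ^^ l) U"
      using that funpow_add[of i "l - i" "partial_preimage T"] by simp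
    finally have "?D i \<inter> ?D l \<subseteq> (partial_preimage T ^^ l) (U \<inter> D)"
      unfolding partial_preimage_funpow_Int by blast
    also have "\<dots> = {}" using D(2) by (auto simp: mem_partial_preimage_funpow)
    finally show ?thesis by blast
  qed
  have "disjoint_family_on ?D {..j}"
    unfolding disjoint_family_on_def using disj by (metis Int_commute atMost_iff linorder_neqE_nat)
  then have "measure \<mu> (\<Union>i\<in>{..j}. ?D i) = (\<Sum>i\<in>{..j}. measure \<mu> (?D i))"
    using D(1) funpow_sets by (intro finite_measure_finite_Union) auto
  also have "\<dots> = real (Suc j) * measure \<mu> D" by (simp add: measure_funpow D(1))
  finally show ?thesis using prob_le_1[of "\<Union>i\<in>{..j}. ?D i"] by (simp add: field_simps)
qed

lemma iterated_Sigma_set: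
  "\<exists>h. cfun {} h \<and> (\<forall>i e. (partial_preimage T ^^ i) (Sigma_set s A 1 e) \<inter> dom T =
     Sigma_set s A 1 ((h ^^ i) e) \<inter> dom T)"
proof -
  obtain h where h: "cfun {} h"
    "\<And>e. partial_preimage T (Sigma_set s A 1 e) = dom T \<inter> Sigma_set s A 1 (h e)"
    using computable_map_Sigma_set[OF computable] by blast
  have "(partial_preimage T ^^ i) (Sigma_set s A 1 e) \<inter> dom T = Sigma_set s A 1 ((h ^^ i) e) \<inter> dom T" for i e
  proof (induction i arbitrary: e)
    case (Suc i)
    have "(partial_preimage T ^^ Suc i) (Sigma_set s A 1 e) \<inter> dom T =
        (partial_preimage T ^^ i) (dom T \<inter> Sigma_set s A 1 (h e)) \<inter> dom T"
      by (simp only: funpow_Suc_right comp_apply h(2))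
    also have "\<dots> = (partial_preimage T ^^ i) (Sigma_set s A 1 (h e)) \<inter> dom T"
      unfolding partial_preimage_funpow_Int using dom_subset_funpow[of i] by blast
    also have "\<dots> = Sigma_set s A 1 ((h ^^ Suc i) e) \<inter> dom T"
      by (simp only: Suc.IH funpow_Suc_right comp_apply)
    finally show ?case .
  qed (simp only: funpow_0)
  with h(1) show ?thesis by blast
qed

text \<open>Openness of \<open>W k\<close> makes its measure lower semicomputable. The other
  direction writes \<open>- measure \<mu> (W k)\<close> as a supremum of lower semicomputable bounds
  (\<open>upper\<close> and \<open>sharp\<close>) built from the open sets
  \<open>G k m t\<close>.\<close>

lemma schnorr_cover:
  fixes B e
  defines "U \<equiv> Sigma_set s B 1 e"
  assumes "computes_real B d (measure \<mu> (- U))"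
  shows "\<exists>W. ceopen s B W \<and> (\<forall>k. measure \<mu> (W k) \<le> (1/2) ^ k) \<and>
    lsc B (\<lambda>k. - measure \<mu> (W k)) \<and>
    (\<forall>k. dom T \<inter> - U \<inter> (\<Inter>i. (partial_preimage T ^^ Suc i) U) \<subseteq> W k)"
proof -
  let ?r = pos_rat_of_code
  let ?pre = "\<lambda>i. partial_preimage T ^^ i"
  obtain L H where LH: "level_sets s B U L H"
    using Sigma_set_level_sets unfolding U_def by blast
  note sets = level_sets_sets[OF LH]
  have open_LH: "ceopen s B L" "ceopen s B H" using LH unfolding level_sets_def by blast+
  have L_H: "L t \<inter> H t = {}" and U_L: "- U \<subseteq> L t" and H_U: "H t \<subseteq> U" for t
    using LH unfolding level_sets_def by blast+
  have "lsc B (\<lambda>_. measure \<mu> (- U))"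
    by (rule computes_real_lsc(1)[of B "\<lambda>_. d"]) (use assms in \<open>auto intro: comp_intros\<close>)
  then have "lsc B (\<lambda>_. measure \<mu> (- U) + -1)"
    by (rule lsc_add) (intro lsc_crat comp_intros)
  then have lsc_U: "lsc B (\<lambda>_. - measure \<mu> U)" using sets(3) by (simp add: measure_Compl)
  obtain a b where
    ab_cfun: "cfun B (\<lambda>z. a (pfst z) (psnd z))" "cfun B (\<lambda>z. b (pfst z) (psnd z))" and
    a_b: "\<And>k m. ?r (a k m) < ?r (b k m)" and
    a_Suc: "\<And>k m. ?r (a k m) < ?r (a k (Suc m))" and
    b_Suc: "\<And>k m. ?r (b k (Suc m)) < ?r (b k m)" and
    gap: "\<And>k m. 1 - (1/2) ^ m < measure \<mu> (L (a k (Suc m)) \<union> H (b k (Suc m)))" and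
    H_b0: "\<And>k. measure \<mu> U - (1/2) ^ Suc k < measure \<mu> (H (b k 0))"
  proof -
    from nested_thresholds[OF LH lsc_U] obtain a b where
      "cfun B (\<lambda>z. a (pfst z) (psnd z))" "cfun B (\<lambda>z. b (pfst z) (psnd z))"
      "\<forall>k m. ?r (a k m) < ?r (b k m) \<and> ?r (a k m) < ?r (a k (Suc m)) \<and> ?r (b k (Suc m)) < ?r (b k m) \<and>
        1 - (1/2) ^ m < measure \<mu> (L (a k (Suc m)) \<union> H (b k (Suc m)))"
      "\<forall>k. measure \<mu> U - (1/2) ^ Suc k < measure \<mu> (H (b k 0))"
      by (elim exE conjE)
    then show thesis by (intro that[of a b]) blast+
  qed
  have a_less_b: "?r (a k m) < ?r (b k m')" for k m m'
  proof -
    have "?r (a k m) \<le> ?r (a k (max m m'))"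
      using lift_Suc_mono_le[of "\<lambda>m. ?r (a k m)" m "max m m'"] a_Suc less_imp_le by auto
    moreover have "?r (b k (max m m')) \<le> ?r (b k m')"
      using lift_Suc_antimono_le[of "\<lambda>m. ?r (b k m)" m' "max m m'"] b_Suc less_imp_le by auto
    ultimately show ?thesis using a_b[of k "max m m'"] by linarith
  qed
  obtain h where h: "cfun {} h" and
    pre_Sigma: "\<And>i e. ?pre i (Sigma_set s B 1 e) \<inter> dom T = Sigma_set s B 1 ((h ^^ i) e) \<inter> dom T"
    using iterated_Sigma_set by blast
  obtain l where l: "cfun {} l" "\<And>t. L t = Sigma_set s B 1 (l t)"
    using ceopen_index[OF open_LH(1)] by blast
  \<comment> \<open>\<open>S\<close> and \<open>SL\<close> are open and agree on
    \<open>dom T\<close> with the preimages of \<open>U\<close> and \<open>L t\<close>, which need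
    not be open in the whole space.\<close>
  define S where "S = (\<lambda>i. Sigma_set s B 1 ((h ^^ i) e))"
  define SL where "SL = (\<lambda>i t. Sigma_set s B 1 ((h ^^ i) (l t)))"
  have pre_U: "?pre i U \<inter> dom T = S i \<inter> dom T" for i
    unfolding U_def S_def by (rule pre_Sigma)
  have pre_L: "?pre i (L t) \<inter> dom T = SL i t \<inter> dom T" for i t
    unfolding l(2) SL_def by (rule pre_Sigma)
  have open_S: "ceopen s B (\<lambda>x. S (i x))" if "cfun B i" for i
    unfolding S_def
    by (intro ceopen_subst[OF ceopen_Sigma_set] cfun_funpow cfun_mono[OF h] comp_intros that)
  have open_SL: "ceopen s B (\<lambda>x. SL (i x) (t x))" if "cfun B i" "cfun B t" for i t
    unfolding SL_def
    by (intro ceopen_subst[OF ceopen_Sigma_set] cfun_funpow cfun_mono[OF h] comp_intros that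
        cfun_comp[OF cfun_mono[OF l(1)]])
  \<comment> \<open>With 2^(k+1) iterates the non-returning part of \<open>- U\<close> has measure
    below 2^-(k+1); \<open>H_b0\<close> grants the same amount to the rest of
    \<open>W k\<close>.\<close>
  define j where "j = (\<lambda>k. 2 ^ Suc k :: nat)"
  have j: "cfun B (\<lambda>x. j (f x))" if "cfun B f" for f
    unfolding j_def by (intro comp_intros that)
  \<comment> \<open>The union over \<open>m\<close> is {f < c} for c the supremum of the thresholds
    \<open>a k m\<close>.\<close>
  define W where "W = (\<lambda>k. (\<Inter>i\<in>{..<j k}. S (Suc i)) \<inter> (\<Union>m. L (a k m)))"
  \<comment> \<open>Nearly complementary to \<open>W k\<close>: the points above
    \<open>b k m\<close> and, on \<open>dom T\<close>, those with one of the next \<open>j k\<close>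
    iterates in the neighbourhood \<open>L t\<close> of \<open>- U\<close>.\<close>
  define G where "G = (\<lambda>k m t. H (b k m) \<union> (\<Union>i\<in>{..<j k}. SL (Suc i) t))"
  have open_W: "ceopen s B W" unfolding W_def
    by (intro ceopen_intros open_S ceopen_subst[OF open_LH(1)] cfun_subst2[OF ab_cfun(1)] j comp_intros)
  have open_G: "ceopen s B (\<lambda>x. G (pfst x) (pfst (psnd x)) (psnd (psnd x)))" unfolding G_def
    by (intro ceopen_Un ceopen_UN_less open_SL ceopen_subst[OF open_LH(2)]
        cfun_subst2[OF ab_cfun(2)] j comp_intros)
  note W_sets = ceopen_sets[OF open_W]
  have G_sets: "G k m t \<in> sets \<mu>" for k m t
    using ceopen_sets[OF open_G, of "prod_encode (k, prod_encode (m, t))"] by simp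
  have pre_sets: "?pre i U \<in> sets \<mu>" "?pre i (U \<inter> L t) \<in> sets \<mu>" for i t
    by (intro funpow_sets sets.Int sets)+
  \<comment> \<open>A point of \<open>W k\<close> is below all upper thresholds, so it lies in
    \<open>- U\<close>, where the recurrence bound applies, or in the thin shell
    \<open>U - H (b k 0)\<close>.\<close>
  have W_dom: "W k \<inter> dom T \<subseteq> (- U \<inter> (\<Inter>i\<in>{..<j k}. ?pre (Suc i) U)) \<union> (U - H (b k 0))" for k
  proof
    fix y assume y: "y \<in> W k \<inter> dom T"
    then obtain m where "y \<in> L (a k m)" unfolding W_def by blast
    then have "y \<notin> H (b k 0)" using level_sets_less(1)[OF LH a_less_b[of k m 0]] L_H by blast
    moreover have "y \<in> ?pre (Suc i) U" if "i < j k" for i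
      using y that pre_U[of "Suc i"] unfolding W_def by blast
    ultimately show "y \<in> (- U \<inter> (\<Inter>i\<in>{..<j k}. ?pre (Suc i) U)) \<union> (U - H (b k 0))" by blast
  qed
  have bound: "measure \<mu> (W k) \<le> (1/2) ^ k" for k
  proof -
    let ?D = "- U \<inter> (\<Inter>i\<in>{..<j k}. ?pre (Suc i) U)"
    have j_pos: "0 < j k" by (simp add: j_def)
    have D_sets: "?D \<in> sets \<mu>"
      using j_pos by (intro sets.Int sets.finite_INT Compl_sets sets(3) pre_sets(1)) auto
    have "measure \<mu> ?D \<le> 1 / real (Suc (j k))"
    proof (rule no_return_measure[OF D_sets])
      fix i assume "1 \<le> i" "i \<le> j k"
      then obtain i' where "i = Suc i'" "i' < j k" by (cases i) auto
      then show "?D \<subseteq> ?pre i U" by blast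
    qed blast
    also have "\<dots> \<le> 1 / real (j k)" using j_pos by (intro divide_left_mono) auto
    also have "\<dots> = (1/2) ^ Suc k" by (simp add: j_def power_divide)
    finally have D: "measure \<mu> ?D \<le> (1/2) ^ Suc k" .
    have "measure \<mu> (W k) = measure \<mu> (W k \<inter> dom T)" by (simp add: measure_Int_dom W_sets)
    also have "\<dots> \<le> measure \<mu> (?D \<union> (U - H (b k 0)))"
      by (intro finite_measure_mono W_dom sets.Un D_sets sets.Diff sets)
    also have "\<dots> \<le> measure \<mu> ?D + measure \<mu> (U - H (b k 0))"
      by (intro measure_Un_le D_sets sets.Diff sets)
    also have "measure \<mu> (U - H (b k 0)) = measure \<mu> U - measure \<mu> (H (b k 0))"
      by (intro finite_measure_Diff sets H_U)
    finally show ?thesis using D H_b0[of k] by simp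
  qed
  \<comment> \<open>\<open>W k\<close> misses \<open>H (b k m)\<close>, so on the overlap with
    \<open>G\<close> some iterate is in \<open>U \<inter> L t\<close>. Each of the
    \<open>j k\<close> preimages of this shell has its measure, which is at most
    \<open>measure \<mu> U - measure \<mu> (H t)\<close>.\<close>
  have upper: "measure \<mu> (G k m t) - 1 + real (j k) * (measure \<mu> (H t) - measure \<mu> U) \<le> - measure \<mu> (W k)"
    for k m t
  proof -
    have "W k \<inter> G k m t \<inter> dom T \<subseteq> (\<Union>i\<in>{..<j k}. ?pre (Suc i) (U \<inter> L t))"
    proof
      fix y assume y: "y \<in> W k \<inter> G k m t \<inter> dom T"
      then obtain m' where "y \<in> L (a k m')" unfolding W_def by blast
      then have "y \<notin> H (b k m)" using level_sets_less(1)[OF LH a_less_b[of k m' m]] L_H by blast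
      with y obtain i where i: "i < j k" "y \<in> SL (Suc i) t" unfolding G_def by blast
      with y have "y \<in> ?pre (Suc i) U \<inter> ?pre (Suc i) (L t)"
        using pre_U[of "Suc i"] pre_L[of "Suc i" t] unfolding W_def by blast
      with i(1) show "y \<in> (\<Union>i\<in>{..<j k}. ?pre (Suc i) (U \<inter> L t))"
        unfolding partial_preimage_funpow_Int by blast
    qed
    then have "measure \<mu> (W k \<inter> G k m t \<inter> dom T) \<le> measure \<mu> (\<Union>i\<in>{..<j k}. ?pre (Suc i) (U \<inter> L t))"
      by (intro finite_measure_mono sets.finite_UN pre_sets(2) finite_lessThan)
    then have "measure \<mu> (W k \<inter> G k m t) \<le> measure \<mu> (\<Union>i\<in>{..<j k}. ?pre (Suc i) (U \<inter> L t))"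
      by (simp only: measure_Int_dom[OF sets.Int[OF W_sets G_sets]])
    also have "\<dots> \<le> (\<Sum>i\<in>{..<j k}. measure \<mu> (?pre (Suc i) (U \<inter> L t)))"
      using pre_sets(2) by (intro finite_measure_subadditive_finite) (auto simp del: funpow.simps)
    also have "\<dots> = real (j k) * measure \<mu> (U \<inter> L t)"
      using sets by (simp only: measure_funpow[OF sets.Int[OF sets(3,1)]]) simp
    also have "measure \<mu> (U \<inter> L t) \<le> measure \<mu> (U - H t)"
      using L_H[of t] sets by (intro finite_measure_mono) auto
    also have "measure \<mu> (U - H t) = measure \<mu> U - measure \<mu> (H t)"
      by (intro finite_measure_Diff sets H_U)
    finally have "measure \<mu> (W k \<inter> G k m t) \<le> real (j k) * (measure \<mu> U - measure \<mu> (H t))"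
      by (simp add: mult_left_mono)
    moreover have "measure \<mu> (W k \<union> G k m t) = measure \<mu> (W k) + measure \<mu> (G k m t) - measure \<mu> (W k \<inter> G k m t)"
      using W_sets G_sets by (intro measure_Un3) (simp_all add: fmeasurable_eq_sets)
    moreover have "measure \<mu> (W k \<union> G k m t) \<le> 1" by (rule prob_le_1)
    ultimately show ?thesis unfolding right_diff_distrib by linarith
  qed
  have sharp: "\<exists>m t. q < measure \<mu> (G k m t) - 1 + real (j k) * (measure \<mu> (H t) - measure \<mu> U)"
    if q: "q < - measure \<mu> (W k)" for q k
  proof -
    \<comment> \<open>Half of the slack goes to the gap between the thresholds, half to the
      \<open>j k\<close> shells.\<close>
    define e' where "e' = (- measure \<mu> (W k) - q) / 2"
    have "0 < e'" using q by (simp add: e'_def)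
    then obtain m where m: "(1/2) ^ m < e'" using half_power_less by blast
    have j_pos: "0 < j k" by (simp add: j_def)
    then obtain t where t: "measure \<mu> U - e' / real (j k) < measure \<mu> (H t)"
      using measure_level_set_approx[OF LH, of "e' / real (j k)"] \<open>0 < e'\<close> by auto
    \<comment> \<open>Off \<open>G\<close>, a point is not in \<open>H (b k (Suc m))\<close>, so
      inside \<open>?X\<close> it is in \<open>L (a k (Suc m))\<close>; its iterates avoid
      \<open>L t\<close>, which contains \<open>- U\<close>, and hence lie in \<open>U\<close>. So
      it belongs to \<open>W k\<close>.\<close>
    let ?X = "L (a k (Suc m)) \<union> H (b k (Suc m))"
    have "- G k (Suc m) t \<inter> dom T \<subseteq> - ?X \<union> W k"
    proof
      fix y assume y: "y \<in> - G k (Suc m) t \<inter> dom T"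
      have "y \<in> S (Suc i)" if "i < j k" for i
      proof -
        from y that have "y \<notin> SL (Suc i) t" unfolding G_def by blast
        with y pre_L[of "Suc i" t] have "y \<notin> ?pre (Suc i) (L t)" by blast
        moreover from y dom_subset_funpow[of "Suc i"] obtain z where "partial_iterate T (Suc i) y = Some z"
          unfolding mem_partial_preimage_funpow subset_iff by blast
        ultimately have "y \<in> ?pre (Suc i) U"
          unfolding mem_partial_preimage_funpow using U_L[of t] by blast
        with y pre_U[of "Suc i"] show ?thesis by blast
      qed
      then show "y \<in> - ?X \<union> W k" using y unfolding W_def G_def by blast
    qed
    then have "measure \<mu> (- G k (Suc m) t \<inter> dom T) \<le> measure \<mu> (- ?X \<union> W k)"
      by (intro finite_measure_mono sets.Un Compl_sets W_sets sets)
    then have "measure \<mu> (- G k (Suc m) t) \<le> measure \<mu> (- ?X \<union> W k)"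
      by (simp only: measure_Int_dom[OF Compl_sets[OF G_sets]])
    also have "\<dots> \<le> measure \<mu> (- ?X) + measure \<mu> (W k)"
      by (intro measure_Un_le sets.Un Compl_sets W_sets sets)
    finally have "1 - measure \<mu> (G k (Suc m) t) \<le> 1 - measure \<mu> ?X + measure \<mu> (W k)"
      by (simp only: measure_Compl[OF G_sets] measure_Compl[OF sets.Un[OF sets(1,2)]])
    moreover have "- e' < real (j k) * (measure \<mu> (H t) - measure \<mu> U)"
      using t j_pos by (simp add: field_simps)
    ultimately have "q < measure \<mu> (G k (Suc m) t) - 1 + real (j k) * (measure \<mu> (H t) - measure \<mu> U)"
      using gap[of m k] m unfolding e'_def by argo
    then show ?thesis by blast
  qed
  have "lsc B (\<lambda>k. - measure \<mu> (W k))"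
  proof (rule lscI)
    have eq: "q < - measure \<mu> (W k) \<longleftrightarrow>
        (\<exists>x. q < (measure \<mu> (G k (pfst x) (psnd x)) + - 1) +
          real (j k) * (measure \<mu> (H (psnd x)) + - measure \<mu> U))" for q k
    proof
      assume "q < - measure \<mu> (W k)"
      from sharp[OF this] obtain m t where
        "q < measure \<mu> (G k m t) - 1 + real (j k) * (measure \<mu> (H t) - measure \<mu> U)" by blast
      then show "\<exists>x. q < (measure \<mu> (G k (pfst x) (psnd x)) + - 1) +
          real (j k) * (measure \<mu> (H (psnd x)) + - measure \<mu> U)"
        by (intro exI[of _ "prod_encode (m, t)"]) simp
    next
      assume "\<exists>x. q < (measure \<mu> (G k (pfst x) (psnd x)) + - 1) +
          real (j k) * (measure \<mu> (H (psnd x)) + - measure \<mu> U)"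
      then obtain x where "q < (measure \<mu> (G k (pfst x) (psnd x)) + - 1) +
          real (j k) * (measure \<mu> (H (psnd x)) + - measure \<mu> U)" by blast
      with upper[of k "pfst x" "psnd x"] show "q < - measure \<mu> (W k)" by simp
    qed
    have "lsc B (\<lambda>x. measure \<mu> (G (pfst x) (pfst (psnd x)) (psnd (psnd x))))"
      by (rule lsc_measure[OF open_G])
    from lsc_subst[OF this] have lsc_G: "lsc B (\<lambda>x. measure \<mu> (G (f x) (g x) (t x)))"
      if "cfun B f" "cfun B g" "cfun B t" for f g t
      using cfun_prod_encode[OF that(1) cfun_prod_encode[OF that(2,3)]] by fastforce
    show "ce B (\<lambda>z. rat_of_code (pfst z) < - measure \<mu> (W (psnd z)))"
      unfolding eq
      by (intro ce_ex ce_crat_less_lsc lsc_add lsc_mult_nat lsc_G lsc_crat lsc_U j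
          lsc_measure ceopen_subst[OF open_LH(2)] comp_intros)
  qed
  moreover have "dom T \<inter> - U \<inter> (\<Inter>i. ?pre (Suc i) U) \<subseteq> W k" for k
  proof
    fix y assume y: "y \<in> dom T \<inter> - U \<inter> (\<Inter>i. ?pre (Suc i) U)"
    then have "y \<in> S (Suc i)" for i using pre_U[of "Suc i"] by blast
    moreover have "y \<in> L (a k 0)" using y U_L by blast
    ultimately show "y \<in> W k" unfolding W_def by blast
  qed
  ultimately show ?thesis using open_W bound by blast
qed

end

theorem theorem4p13:
  fixes s :: "nat \<Rightarrow> 'a::polish_space" and \<mu> :: "'a measure"
    and n :: nat and A :: "nat set" and x :: 'a and P :: "'a set" and T :: "'a \<rightharpoonup> 'a"
  assumes "computable_prob_space s \<mu>"
    and "n \<ge> 1"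
    and "schnorr_random s \<mu> A n x"
    and "quasi_Pi_generic s \<mu> A n x"
    and "is_Pi s A n P" and "x \<in> P" and "measure \<mu> P > 0"
    and "measure_preserving_map \<mu> T" and "computable_map s T" and "x \<in> dom T"
  shows "\<exists>k>0. \<exists>y\<in>P. partial_iterate T k x = Some y"
proof (rule ccontr)
  assume no_return: "\<not> ?thesis"
  interpret prob_space \<mu> using assms(1) by (simp add: computable_prob_space_def)
  interpret computable_system s \<mu> T
    using assms(1,8,9) by unfold_locales (simp_all add: computable_prob_space_def)
  define B where "B = iter_jump (n - 1) A"
  obtain Q e d where Q: "- Q = Sigma_set s B 1 e" "Q \<subseteq> P" "x \<in> Q"
    "computes_real B d (measure \<mu> Q)"
    using assms(4-6) unfolding quasi_Pi_generic_def is_Pi_def is_Sigma_def B_def by metis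
  let ?U = "Sigma_set s B 1 e"
  have Q_eq: "- ?U = Q" unfolding Q(1)[symmetric] by (rule double_complement)
  obtain W where W: "ceopen s B W" "\<And>k. measure \<mu> (W k) \<le> (1/2) ^ k"
    "lsc B (\<lambda>k. - measure \<mu> (W k))"
    "\<And>k. dom T \<inter> Q \<inter> (\<Inter>i. (partial_preimage T ^^ Suc i) ?U) \<subseteq> W k"
    using schnorr_cover[of B d e] Q(4) unfolding Q_eq by blast
  \<comment> \<open>Membership in an iterated preimage includes that the iterate is defined; this
    comes from \<open>x \<in> dom T\<close> and the invariance of the domain.\<close>
  have "x \<in> (partial_preimage T ^^ Suc i) ?U" for i
  proof -
    obtain y where y: "partial_iterate T (Suc i) x = Some y"
      using dom_subset_funpow[of "Suc i"] assms(10) unfolding subset_iff mem_partial_preimage_funpow by blast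
    then have "y \<notin> P" using no_return by blast
    then have "y \<in> ?U" using Q(1,2) by blast
    with y show ?thesis unfolding mem_partial_preimage_funpow by blast
  qed
  then have "x \<in> (\<Inter>k. W k)" using W(4) Q(3) assms(10) by blast
  moreover have "schnorr_test s \<mu> A n W"
  proof -
    obtain g where g: "cfun {} g" "\<And>k. W k = Sigma_set s B 1 (g k)"
      using ceopen_index[OF W(1)] by blast
    \<comment> \<open>The test is Sigma_1 relative to \<open>B\<close>, while Sigma_n(A) indices are
      required; the translation is composed with the index function.\<close>
    obtain h where h: "cfun {} h" "\<And>e. Sigma_set s B 1 e = Sigma_set s A n (h e)"
      using Sigma_set_iter_jump[of "n - 1" A] assms(2) unfolding B_def by auto
    have "uniformly (\<lambda>e V. V = Sigma_set s A n e) W"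
      unfolding uniformly_def computable_fun_iff
      by (intro exI[of _ "\<lambda>k. h (g k)"]) (simp add: cfun_comp[OF h(1) g(1)] g(2) h(2) del: Sigma_set.simps One_nat_def)
    moreover have "uniformly (computes_real B) (\<lambda>k. measure \<mu> (W k))"
      by (rule lsc_uniformly_computes_real[OF lsc_measure[OF W(1)] W(3)])
    ultimately show ?thesis using W(2) unfolding schnorr_test_def B_def by blast
  qed
  ultimately show False using assms(3) unfolding schnorr_random_def by blast
qed

end
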